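(* Let $\chi:\{0,1,2,\ldots\}\to\{-1,0,1\}$ be a partial colouring of the non-negative integers with density $\rho>0$, and for each $n$ let $\chi_n$ denote the restriction of $\chi$ to $\{0,1,\ldots,n\}$. For $\alpha>1$ let $D_\alpha(n)$ be the maximum, over all integers $0\le s\le t$ with $\lfloor t\alpha\rfloor\le n$, of $\left|\sum_{k=s}^{t}\chi_n(\lfloor k\alpha\rfloor)\right|$. Then for almost every (with respect to Lebesgue measure) $\alpha\in[1,\infty)$ there are infinitely many $n$ such that $D_\alpha(n)\ge(\log n)^{1/4-o(1)}$; that is, for almost every $\alpha\in[1,\infty)$ and every $\varepsilon>0$ there are infinitely many $n$ with $D_\alpha(n)\ge(\log n)^{1/4-\varepsilon}$.
   Context: A partial colouring is a map $\chi$ to $\{-1,0,1\}$ (the value $0$ meaning "uncoloured"). "Density $\rho$" means that the set $\{b\ge0:\chi(b)\neq0\}$ of coloured integers has asymptotic density $\rho$. The quasi-progression $Q(\alpha;s,t)$ is the sequence $\lfloor s\alpha\rfloor,\lfloor(s+1)\alpha\rfloor,\ldots,\lfloor t\alpha\rfloor$, and $D_\alpha(n)$ is the maximum discrepancy $\left|\sum\chi_n\right|$ of such quasi-progressions lying in $\{0,\ldots,n\}$. *)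

theory Defs
  imports "HOL-Analysis.Analysis"
begin

definition partial_colouring :: "(nat \<Rightarrow> int) \<Rightarrow> bool" where
  "partial_colouring c \<longleftrightarrow> range c \<subseteq> {-1, 0, 1}"

definition has_asymptotic_density :: "nat set \<Rightarrow> real \<Rightarrow> bool" where
  "has_asymptotic_density A \<rho> \<longleftrightarrow>
     (\<lambda>n. real (card (A \<inter> {..<n})) / real n) \<longlonglongrightarrow> \<rho>"

definition colouring_density :: "(nat \<Rightarrow> int) \<Rightarrow> real \<Rightarrow> bool" where
  "colouring_density c \<rho> \<longleftrightarrow> has_asymptotic_density {b. c b \<noteq> 0} \<rho>"

definition quasi_sum :: "(nat \<Rightarrow> int) \<Rightarrow> real \<Rightarrow> nat \<Rightarrow> nat \<Rightarrow> int" where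
  "quasi_sum c \<alpha> s t = (\<Sum>k = s..t. c (nat \<lfloor>real k * \<alpha>\<rfloor>))"

(* For \<alpha> \<ge> 1 the set below is finite, since t \<le> \<lfloor>t * \<alpha>\<rfloor> \<le> n, and it is nonempty
   (s = t = 0), so Max is meaningful.  The term restrict c {..n} is the colouring c_n; its
   values outside {..n} are never used, because k \<le> t gives \<lfloor>k * \<alpha>\<rfloor> \<le> \<lfloor>t * \<alpha>\<rfloor> \<le> n. *)
definition quasi_discrepancy :: "(nat \<Rightarrow> int) \<Rightarrow> real \<Rightarrow> nat \<Rightarrow> int" where
  "quasi_discrepancy c \<alpha> n =
     Max {\<bar>quasi_sum (restrict c {..n}) \<alpha> s t\<bar> | s t. s \<le> t \<and> \<lfloor>real t * \<alpha>\<rfloor> \<le> int n}"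

end

theory Submission
  imports Defs "HOL-Real_Asymp.Real_Asymp"
begin

text \<open>
  For fixed \<open>y\<close> let \<open>P k\<close> be the sum of \<open>c \<lfloor>i y\<rfloor>\<close> over \<open>s \<le> i < k\<close>. If \<open>\<bar>P\<bar> \<le> D\<close> on
  \<open>[s, 2s)\<close>, Bessel's inequality for the Haar system bounds the sum over all dyadic lengths
  \<open>2d\<close> of the normalised Haar energies of \<open>P\<close> by \<open>s D\<^sup>2\<close>. Conversely, when \<open>y\<close> grows past a
  fraction \<open>b / k\<close>, only the \<open>k\<close>-th term changes, by \<open>c b - c (b - 1)\<close>. A jump \<open>c b \<noteq> c (b - 1)\<close>
  therefore forces, on one side of \<open>b / k\<close> at least, a Haar coefficient of size about \<open>d\<close>.
  Since bounded discrepancy forbids long constant runs, jumps have density at least of order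
  \<open>1 / D\<close>, so each of about \<open>log s\<close> dyadic lengths contributes an energy of order \<open>s / D\<close>,
  whence \<open>log s = O(D\<^sup>3)\<close>.

  This must be carried out with \<open>y\<close> restricted to a set \<open>A\<close> of positive measure. \<open>A\<close> has density
  close to \<open>1\<close> in some interval, and a second moment estimate (through the number of \<open>k\<close> with
  \<open>k b' / b\<close> being \<open>\<epsilon>\<close>-close to an integer and Dirichlet's theorem) shows that the neighbourhoods of the fractions \<open>b / k\<close>
  cannot concentrate on the small complement of \<open>A\<close>, however sparse the jumps are.
\<close>

section \<open>Haar coefficients: Bessel's inequality and the effect of one jump\<close>

text \<open>Unnormalised Haar coefficient on the block of length \<open>2 * d\<close> from
  \<open>v\<close>: second half minus first half. The Haar function has squared norm
  \<open>2 * d\<close>, so \<open>(haar P v d)\<^sup>2 / (2 * d)\<close> is the normalised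
  energy.\<close>

definition haar :: "(nat \<Rightarrow> real) \<Rightarrow> nat \<Rightarrow> nat \<Rightarrow> real" where
  "haar P v d = (\<Sum>j<d. P (v + d + j) - P (v + j))"

lemma sum_lessThan_double_split:
  fixes f :: "nat \<Rightarrow> real"
  shows "(\<Sum>i<2 * d. f i) = (\<Sum>i<d. f i) + (\<Sum>i<d. f (d + i))"
proof -
  have "(\<Sum>i<d + n. f i) = (\<Sum>i<d. f i) + (\<Sum>i<n. f (d + i))" for n
    by (induction n) auto
  from this[of d] show ?thesis by (simp add: mult_2)
qed

lemma sum_lessThan_double_pairs:
  fixes f :: "nat \<Rightarrow> real"
  shows "(\<Sum>j<2 * m. f j) = (\<Sum>j<m. f (2 * j) + f (2 * j + 1))"
  by (induction m) (auto simp: algebra_simps)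

text \<open>\<open>Q r\<close> is the energy of the averages of \<open>P\<close> over blocks of
  length \<open>2 ^ r\<close>, and \<open>H r\<close> that of the Haar coefficients on blocks twice
  as long. The parallelogram law gives \<open>Q r = Q (Suc r) + H r\<close>; telescoping leaves the
  nonnegative remainder \<open>Q R\<close>.\<close>

lemma haar_bessel:
  assumes "R \<le> w"
  shows "(\<Sum>r<R. 1 / 2 ^ Suc r * (\<Sum>j<2 ^ (w - Suc r). (haar P (s + j * 2 ^ Suc r) (2 ^ r))\<^sup>2))
         \<le> (\<Sum>k<2 ^ w. (P (s + k))\<^sup>2)"
proof -
  define Q where "Q r = (\<Sum>j<2 ^ (w - r). (\<Sum>i<2 ^ r. P (s + j * 2 ^ r + i))\<^sup>2 / 2 ^ r)" for r
  define H where "H r = 1 / 2 ^ Suc r * (\<Sum>j<2 ^ (w - Suc r). (haar P (s + j * 2 ^ Suc r) (2 ^ r))\<^sup>2)" for r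
  have step: "Q r = Q (Suc r) + H r" if "r < w" for r
  proof -
    let ?d = "2 ^ r :: nat" and ?m = "2 ^ (w - Suc r) :: nat"
    have m: "2 ^ (w - r) = 2 * ?m"
      using that by (metis Suc_diff_Suc power_Suc)
    define L where "L j = (\<Sum>i<?d. P (s + j * (2 * ?d) + i))" for j
    define R' where "R' j = (\<Sum>i<?d. P (s + j * (2 * ?d) + ?d + i))" for j
    have "Q r = (\<Sum>j<?m. (L j)\<^sup>2 / 2 ^ r + (R' j)\<^sup>2 / 2 ^ r)"
      unfolding Q_def m sum_lessThan_double_pairs L_def R'_def
      by (intro sum.cong) (auto simp: algebra_simps)
    also have "\<dots> = (\<Sum>j<?m. (L j + R' j)\<^sup>2 / 2 ^ Suc r + (R' j - L j)\<^sup>2 / 2 ^ Suc r)"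
      by (intro sum.cong refl) (simp add: power2_eq_square field_simps)
    also have "\<dots> = (\<Sum>j<?m. (L j + R' j)\<^sup>2 / 2 ^ Suc r) + (\<Sum>j<?m. (R' j - L j)\<^sup>2 / 2 ^ Suc r)"
      by (rule sum.distrib)
    also have "(\<Sum>j<?m. (L j + R' j)\<^sup>2 / 2 ^ Suc r) = Q (Suc r)"
      unfolding Q_def L_def R'_def power_Suc sum_lessThan_double_split
      by (intro sum.cong) (auto simp: algebra_simps)
    also have "(\<Sum>j<?m. (R' j - L j)\<^sup>2 / 2 ^ Suc r) = H r"
      unfolding H_def L_def R'_def haar_def power_Suc sum_distrib_left sum_subtractf
      by (intro sum.cong) (auto simp: algebra_simps)
    finally show ?thesis .
  qed
  have "Q 0 = Q R + (\<Sum>r<R. H r)" using assms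
    by (induction R) (auto simp: step)
  moreover have "Q R \<ge> 0" unfolding Q_def by (intro sum_nonneg) auto
  ultimately have "(\<Sum>r<R. H r) \<le> Q 0" by simp
  then show ?thesis by (simp add: Q_def H_def)
qed

text \<open>The constant \<open>C\<close> cancels between the two halves; what survives is
  \<open>e\<close> times the number of \<open>j < d\<close> with
  \<open>v + j \<le> k < v + d + j\<close>. For \<open>k\<close> in the middle half of the block
  this number is at least \<open>d / 2\<close>.\<close>

lemma haar_jump:
  fixes P P' :: "nat \<Rightarrow> real"
  assumes jump: "\<And>i. v \<le> i \<Longrightarrow> i < v + 2 * d \<Longrightarrow> P' i - P i = C + (if k < i then e else 0)"
    and "v \<le> k" "d \<le> 2 * (k - v)" "2 * (k - v) < 3 * d" "even d"
  shows "\<bar>haar P' v d - haar P v d\<bar> \<ge> real d / 2 * \<bar>e\<bar>"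
proof -
  define t where "t = k - v"
  have k: "k = v + t" using assms(2) by (simp add: t_def)
  define J where "J = {j. j < d \<and> j \<le> t \<and> t < d + j}"
  have "haar P' v d - haar P v d
        = (\<Sum>j<d. (P' (v + d + j) - P (v + d + j)) - (P' (v + j) - P (v + j)))"
    unfolding haar_def sum_subtractf[symmetric] by (intro sum.cong) auto
  also have "\<dots> = (\<Sum>j<d. if j \<in> J then e else 0)"
  proof (intro sum.cong refl)
    fix j assume "j \<in> {..<d}"
    then show "(P' (v + d + j) - P (v + d + j)) - (P' (v + j) - P (v + j)) = (if j \<in> J then e else 0)"
      by (simp add: jump k J_def)
  qed
  also have "\<dots> = real (card J) * e"
    by (subst sum.inter_restrict[symmetric]) (auto simp: J_def Int_def)
  finally have diff: "haar P' v d - haar P v d = real (card J) * e" .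
  have "d \<le> 2 * card J"
  proof (cases "t < d")
    case True
    then have "J = {..t}" by (auto simp: J_def)
    then show ?thesis using assms(3) by (simp add: t_def)
  next
    case False
    then have "J = {Suc t - d..<d}" using assms(4) by (auto simp: J_def)
    then have "card J = 2 * d - Suc t" using False by simp
    moreover have "2 * t < 3 * d" using assms(4) by (simp add: t_def)
    \<comment> \<open>Evenness sharpens \<open>2 * t < 3 * d\<close> to
      \<open>2 * t + 2 \<le> 3 * d\<close>, which absorbs the \<open>Suc\<close> in
      \<open>card J\<close>.\<close>
    ultimately show ?thesis using \<open>even d\<close> by presburger
  qed
  then have "real d / 2 \<le> real (card J)" by linarith
  then have "real d / 2 * \<bar>e\<bar> \<le> real (card J) * \<bar>e\<bar>" by (rule mult_right_mono) simp
  then show ?thesis unfolding diff abs_mult by simp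
qed

section \<open>Counting: central indices, multiples near integers, well-approximable ratios\<close>

text \<open>The position of \<open>k\<close> in its block between consecutive multiples of
  \<open>2 * d\<close> lies in the middle half, as \<open>haar_jump\<close> requires.\<close>

definition central :: "nat \<Rightarrow> nat \<Rightarrow> bool" where
  "central d k \<longleftrightarrow> d \<le> 2 * (k mod (2 * d)) \<and> 2 * (k mod (2 * d)) < 3 * d"

lemma central_shift:
  assumes "d > 0" "\<not> central d k"
  shows "central d (k + d)"
proof -
  define x where "x = k mod (2 * d)"
  have x: "x < 2 * d" using assms(1) by (simp add: x_def)
  have "(k + d) mod (2 * d) = (x + d) mod (2 * d)" by (simp add: x_def mod_add_left_eq)
  also have "\<dots> = (if x < d then x + d else x - d)"
    using x by (simp add: mod_if)
  finally show ?thesis using assms x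
    by (auto simp: central_def x_def[symmetric] split: if_splits)
qed

text \<open>Translation by \<open>d\<close> injects the non-central indices into the central ones,
  apart from at most \<open>d\<close> images that leave the interval at its right end.\<close>

lemma card_central:
  assumes "d > 0"
  shows "m \<le> l + d + 2 * card {k \<in> {l..<m}. central d k}"
proof -
  let ?C = "{k \<in> {l..<m}. central d k}" and ?N = "{k \<in> {l..<m}. \<not> central d k}"
  have "card ?N = card ((\<lambda>k. k + d) ` ?N)" by (simp add: card_image)
  also have "\<dots> \<le> card (?C \<union> {m..<m + d})"
    by (intro card_mono) (auto simp: central_shift[OF assms])
  also have "\<dots> \<le> card ?C + d" using card_Un_le[of ?C "{m..<m + d}"] by simp
  finally have "card ?N \<le> card ?C + d" .
  moreover have "card ?C + card ?N = card {l..<m}"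
    by (subst card_Un_disjoint[symmetric]) (auto intro!: arg_cong[where f = card] simp del: card_atLeastLessThan)
  ultimately show ?thesis by simp
qed

lemma card_int_between:
  fixes x y :: real
  assumes "x \<le> y + 1"
  shows "finite {n :: int. x \<le> n \<and> n \<le> y}" "real (card {n :: int. x \<le> n \<and> n \<le> y}) \<le> y - x + 1"
proof -
  have eq: "{n :: int. x \<le> n \<and> n \<le> y} = {\<lceil>x\<rceil>..\<lfloor>y\<rfloor>}"
    by (auto simp: ceiling_le_iff le_floor_iff)
  show "finite {n :: int. x \<le> n \<and> n \<le> y}" unfolding eq by simp
  show "real (card {n :: int. x \<le> n \<and> n \<le> y}) \<le> y - x + 1"
    unfolding eq using assms by simp linarith
qed

lemma card_nat_between:
  fixes x y :: real
  assumes "x \<le> y + 1"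
  shows "finite {n :: nat. x \<le> n \<and> n \<le> y}" "real (card {n :: nat. x \<le> n \<and> n \<le> y}) \<le> y - x + 1"
proof -
  let ?A = "{n :: nat. x \<le> n \<and> n \<le> y}" and ?B = "{n :: int. x \<le> n \<and> n \<le> y}"
  have sub: "int ` ?A \<subseteq> ?B" by auto
  show "finite ?A"
    using finite_subset[OF sub card_int_between(1)[OF assms]] by (rule finite_imageD) auto
  have "card ?A = card (int ` ?A)" by (simp add: card_image)
  also have "\<dots> \<le> card ?B" by (rule card_mono[OF card_int_between(1)[OF assms] sub])
  finally show "real (card ?A) \<le> y - x + 1" using card_int_between(2)[OF assms] by linarith
qed

lemma nat_open_interval_eq:
  fixes x y :: real
  assumes "0 \<le> x"
  shows "{k :: nat. x < k \<and> k < y} = {nat (\<lfloor>x\<rfloor> + 1)..<nat \<lceil>y\<rceil>}"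
proof -
  have "x < real k \<longleftrightarrow> nat (\<lfloor>x\<rfloor> + 1) \<le> k" for k using assms by linarith
  moreover have "real k < y \<longleftrightarrow> k < nat \<lceil>y\<rceil>" for k using assms by linarith
  ultimately show ?thesis by auto
qed

text \<open>If \<open>f k\<close> is the integer near \<open>k * \<theta>\<close>, then
  \<open>g k = (k - l) * h - q * f k\<close> lies within \<open>q * \<epsilon> + 1\<close> of a
  fixed number. It determines \<open>k\<close> modulo \<open>q\<close> by coprimality, hence
  \<open>k\<close> itself in a block of length \<open>q\<close>. This leaves at most
  \<open>2 * q * \<epsilon> + 3\<close> values, and \<open>q * \<epsilon> > 1\<close>.\<close>

lemma card_near_integer_block:
  fixes \<theta> \<epsilon> :: real and h q :: int
  assumes cop: "coprime h q" and "0 < q" "q \<le> int N" and appr: "\<bar>of_int q * \<theta> - of_int h\<bar> < 1 / N"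
    and "1 / \<epsilon> < q" "\<epsilon> > 0"
  shows "real (card {k \<in> {l..<l + nat q}. \<exists>f::int. \<bar>real k * \<theta> - f\<bar> \<le> \<epsilon>}) \<le> 5 * \<epsilon> * q"
proof -
  let ?K = "{k \<in> {l..<l + nat q}. \<exists>f::int. \<bar>real k * \<theta> - f\<bar> \<le> \<epsilon>}"
  define f where "f k = (SOME f::int. \<bar>real k * \<theta> - f\<bar> \<le> \<epsilon>)" for k :: nat
  have f: "\<bar>real k * \<theta> - f k\<bar> \<le> \<epsilon>" if "k \<in> ?K" for k
    unfolding f_def using that by (intro someI_ex[of "\<lambda>f::int. \<bar>real k * \<theta> - f\<bar> \<le> \<epsilon>"]) simp
  define g where "g k = (int k - int l) * h - q * f k" for k :: nat
  define c where "c = - (of_int q * (real l * \<theta>))"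
  have N: "N > 0" using assms by linarith
  have rng: "c - (q * \<epsilon> + 1) \<le> g k \<and> g k \<le> c + (q * \<epsilon> + 1)" if "k \<in> ?K" for k
  proof -
    have kl: "l \<le> k" "real k - real l \<le> q" using that \<open>0 < q\<close> by auto
    have e: "of_int (g k) - c = of_int q * (real k * \<theta> - f k) - (real k - real l) * (of_int q * \<theta> - of_int h)"
      using kl by (simp add: g_def c_def algebra_simps)
    have "\<bar>of_int q * (real k * \<theta> - f k)\<bar> \<le> q * \<epsilon>"
      using f[OF that] \<open>0 < q\<close> by (simp add: abs_mult mult_left_mono)
    moreover have "\<bar>(real k - real l) * (of_int q * \<theta> - of_int h)\<bar> \<le> q * (1 / N)"
      unfolding abs_mult using kl appr by (intro mult_mono) auto
    moreover have "q * (1 / N) \<le> 1" using \<open>q \<le> int N\<close> N by (simp add: divide_simps)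
    ultimately have "\<bar>of_int (g k) - c\<bar> \<le> q * \<epsilon> + 1" unfolding e by linarith
    then show ?thesis by linarith
  qed
  have inj: "inj_on g ?K"
  proof (rule inj_onI)
    fix k k' assume k: "k \<in> ?K" "k' \<in> ?K" and eq: "g k = g k'"
    have "(int k - int k') * h = q * (f k - f k')" using eq by (simp add: g_def algebra_simps)
    then have "q dvd (int k - int k') * h" by simp
    then have "q dvd int k - int k'" using cop by (metis coprime_commute coprime_dvd_mult_left_iff)
    moreover have "\<bar>int k - int k'\<bar> < q" using k \<open>0 < q\<close> by auto
    ultimately have "int k - int k' = 0"
      using dvd_imp_le_int[of "int k - int k'" q] \<open>0 < q\<close> by (cases "int k - int k' = 0") auto
    then show "k = k'" by simp
  qed
  let ?G = "{n :: int. c - (q * \<epsilon> + 1) \<le> n \<and> n \<le> c + (q * \<epsilon> + 1)}"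
  have q\<epsilon>: "q * \<epsilon> > 1" using assms by (simp add: divide_simps mult.commute)
  have "card ?K = card (g ` ?K)" by (rule card_image[OF inj, symmetric])
  also have "\<dots> \<le> card ?G"
  proof (rule card_mono)
    show "finite ?G" using q\<epsilon> by (intro card_int_between(1)) linarith
    show "g ` ?K \<subseteq> ?G" using rng by blast
  qed
  finally have "real (card ?K) \<le> 2 * (q * \<epsilon>) + 3"
    using card_int_between(2)[of "c - (q * \<epsilon> + 1)" "c + (q * \<epsilon> + 1)"] q\<epsilon> by linarith
  then show ?thesis using q\<epsilon> by (simp add: algebra_simps)
qed

text \<open>Dirichlet's theorem supplies a denominator \<open>q \<le> N\<close>, and
  \<open>noapprox\<close> forces \<open>q > 1 / \<epsilon>\<close>. The range is covered by
  \<open>len div q + 1\<close> blocks of length \<open>q\<close>; the overshoot of at most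
  \<open>q\<close> accounts for the summand \<open>N\<close>.\<close>

lemma card_near_integer:
  fixes \<theta> \<epsilon> :: real
  assumes "\<epsilon> > 0" "N > 0"
    and noapprox: "\<And>q::nat. \<And>p::int. 1 \<le> q \<Longrightarrow> real q \<le> 1 / \<epsilon> \<Longrightarrow> \<bar>real q * \<theta> - p\<bar> \<ge> 1 / real N"
  shows "real (card {k \<in> {l..<l + len}. \<exists>f::int. \<bar>real k * \<theta> - f\<bar> \<le> \<epsilon>}) \<le> 5 * \<epsilon> * (real len + real N)"
proof -
  obtain h q where hq: "coprime h q" "0 < q" "q \<le> int N" "\<bar>of_int q * \<theta> - of_int h\<bar> < 1 / real N"
    using Dirichlet_approx_coprime[OF assms(2), of \<theta>] by metis
  have q: "1 / \<epsilon> < q"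
    using noapprox[of "nat q" h] hq by force
  let ?K = "\<lambda>a b. {k \<in> {a..<b}. \<exists>f::int. \<bar>real k * \<theta> - f\<bar> \<le> \<epsilon>}"
  have multi: "real (card (?K l (l + m * nat q))) \<le> m * (5 * \<epsilon> * q)" for m
  proof (induction m)
    case (Suc m)
    have "?K l (l + Suc m * nat q) = ?K l (l + m * nat q) \<union> ?K (l + m * nat q) (l + m * nat q + nat q)"
      by (auto simp: algebra_simps)
    then have "card (?K l (l + Suc m * nat q)) \<le> card (?K l (l + m * nat q)) + card (?K (l + m * nat q) (l + m * nat q + nat q))"
      by (simp only: card_Un_le)
    then show ?case
      using Suc card_near_integer_block[OF hq q \<open>\<epsilon> > 0\<close>, of "l + m * nat q"]
      by (simp add: algebra_simps)
  qed simp
  define m where "m = len div nat q + 1"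
  have nq: "nat q > 0" using hq by simp
  have "len < m * nat q"
    unfolding m_def using nq by (metis Suc_eq_plus1 dividend_less_div_times add.commute mult_Suc)
  then have "card (?K l (l + len)) \<le> card (?K l (l + m * nat q))"
    by (intro card_mono) auto
  also have "real \<dots> \<le> m * (5 * \<epsilon> * q)" by (rule multi)
  also have "\<dots> = 5 * \<epsilon> * (m * real (nat q))" using hq by simp
  also have "\<dots> \<le> 5 * \<epsilon> * (real len + real N)"
  proof -
    have "len div nat q * nat q \<le> len" by simp
    moreover have "nat q \<le> N" using hq by simp
    ultimately have "m * nat q \<le> len + N" by (metis add_mono add_mult_distrib m_def mult_1)
    then have "real m * real (nat q) \<le> real len + real N" by (metis of_nat_add of_nat_le_iff of_nat_mult)
    then show ?thesis using \<open>\<epsilon> > 0\<close> by (intro mult_left_mono) auto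
  qed
  finally show ?thesis by simp
qed

text \<open>Each such \<open>b'\<close> is within \<open>b / N\<close> of some
  \<open>p * b / q\<close>. Since \<open>b' / b\<close> lies in \<open>[0, 2]\<close>, only
  \<open>0 \<le> p \<le> 2 * Q\<close> can occur, so the bound is the number of pairs
  \<open>(q, p)\<close> times the number of integers in one interval.\<close>

lemma card_well_approximable:
  fixes b Q N :: nat
  assumes "b > 0" "N > 0"
  shows "finite {b'. b' \<le> 2 * b \<and> (\<exists>q::nat. 1 \<le> q \<and> q \<le> Q \<and> (\<exists>p::int. \<bar>real q * (real b' / real b) - p\<bar> < 1 / N))}" (is "finite ?X")
    "real (card {b'. b' \<le> 2 * b \<and> (\<exists>q::nat. 1 \<le> q \<and> q \<le> Q \<and> (\<exists>p::int. \<bar>real q * (real b' / real b) - p\<bar> < 1 / N))})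
       \<le> real Q * (2 * real Q + 1) * (2 * real b / N + 1)"
proof -
  show "finite ?X" by (rule finite_subset[of _ "{..2 * b}"]) auto
  define B where "B qp = (case qp of (q, p) \<Rightarrow>
      {b' :: nat. real p * b / q - b / N \<le> b' \<and> b' \<le> real p * b / q + b / N})" for qp :: "nat \<times> nat"
  have card_B: "finite (B qp)" "real (card (B qp)) \<le> 2 * real b / N + 1" for qp
    using card_nat_between[of "real (snd qp) * b / fst qp - b / N" "real (snd qp) * b / fst qp + b / N"] assms
    by (auto simp: B_def split: prod.splits)
  let ?I = "{1..Q} \<times> {0..2 * Q}"
  have sub: "?X \<subseteq> (\<Union>qp\<in>?I. B qp)"
  proof
    fix b' assume "b' \<in> ?X"
    then obtain q :: nat and p :: int where q: "b' \<le> 2 * b" "1 \<le> q" "q \<le> Q"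
      and p: "\<bar>real q * (real b' / real b) - p\<bar> < 1 / N" by auto
    have N1: "1 / real N \<le> 1" using assms by simp
    have th: "0 \<le> real b' / b" "real b' / b \<le> 2" using q assms by (auto simp: divide_simps)
    have "0 \<le> real q * (real b' / b)" using th by simp
    moreover have "real q * (real b' / b) \<le> real q * 2" using th by (intro mult_left_mono) auto
    ultimately have "p > -1" "p < 2 * int q + 1" using p N1 by linarith+
    then have p0: "0 \<le> p" "nat p \<le> 2 * Q" using q by auto
    have "\<bar>real b' - p * b / q\<bar> = \<bar>real q * (real b' / real b) - p\<bar> * (b / q)"
      using q assms by (simp add: abs_mult[symmetric] field_simps flip: abs_of_nonneg)
    also have "\<dots> \<le> 1 / N * (b / 1)" using p q by (intro mult_mono frac_le) auto
    finally have "\<bar>real b' - p * b / q\<bar> \<le> b / N" by simp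
    then have "b' \<in> B (q, nat p)" using p0 by (simp add: B_def) linarith
    then show "b' \<in> (\<Union>qp\<in>?I. B qp)" using q p0 by force
  qed
  have "card ?X \<le> card (\<Union>qp\<in>?I. B qp)" by (intro card_mono sub) (auto simp: card_B)
  also have "\<dots> \<le> (\<Sum>qp\<in>?I. card (B qp))" by (rule card_UN_le) auto
  finally have "real (card ?X) \<le> (\<Sum>qp\<in>?I. real (card (B qp)))" by (simp flip: of_nat_sum)
  also have "\<dots> \<le> (\<Sum>qp\<in>?I. 2 * real b / N + 1)" by (intro sum_mono card_B)
  also have "\<dots> = real Q * (2 * real Q + 1) * (2 * real b / N + 1)" by (simp add: algebra_simps)
  finally show "real (card ?X) \<le> real Q * (2 * real Q + 1) * (2 * real b / N + 1)" .
qed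

section \<open>Measure-theoretic tools: integration, Cauchy-Schwarz, density intervals\<close>

lemma weighted_measure_sum_le:
  fixes w :: "'i \<Rightarrow> real"
  assumes "finite I" "A \<in> fmeasurable M" and Y: "\<And>i. i \<in> I \<Longrightarrow> Y i \<in> sets M" "\<And>i. i \<in> I \<Longrightarrow> Y i \<subseteq> A"
    and bound: "\<And>y. y \<in> A \<Longrightarrow> (\<Sum>i\<in>I. w i * indicator (Y i) y) \<le> B"
  shows "(\<Sum>i\<in>I. w i * measure M (Y i)) \<le> B * measure M A"
proof -
  have fm: "Y i \<in> fmeasurable M" if "i \<in> I" for i
    using fmeasurableI2[OF assms(2) Y(2)[OF that] Y(1)[OF that]] .
  have int: "integrable M (indicator (Y i) :: _ \<Rightarrow> real)" if "i \<in> I" for i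
    using fm[OF that] by (simp add: fmeasurable_def)
  have intA: "integrable M (indicator A :: _ \<Rightarrow> real)"
    using assms(2) by (simp add: fmeasurable_def)
  have "(\<Sum>i\<in>I. w i * measure M (Y i)) = (\<Sum>i\<in>I. \<integral>y. w i * indicator (Y i) y \<partial>M)"
    using Y by (intro sum.cong) (auto simp: sets.sets_into_space Int_absorb2)
  also have "\<dots> = (\<integral>y. (\<Sum>i\<in>I. w i * indicator (Y i) y) \<partial>M)"
    using int by (subst Bochner_Integration.integral_sum) auto
  also have "\<dots> \<le> (\<integral>y. B * indicator A y \<partial>M)"
  proof (intro integral_mono)
    fix y
    show "(\<Sum>i\<in>I. w i * indicator (Y i) y) \<le> B * indicator A y"
    proof (cases "y \<in> A")
      case False
      then have "indicator (Y i) y = (0 :: real)" if "i \<in> I" for i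
        using Y(2)[OF that] by (auto simp: indicator_def)
      then have "(\<Sum>i\<in>I. w i * indicator (Y i) y) = 0" by simp
      then show ?thesis using False by simp
    qed (use bound in simp)
  qed (use int intA in \<open>auto intro!: Bochner_Integration.integrable_sum\<close>)
  also have "\<dots> = B * measure M A"
    using assms(2) by (simp add: fmeasurableD sets.sets_into_space Int_absorb2)
  finally show ?thesis .
qed

text \<open>Cauchy-Schwarz for the indicator of \<open>H\<close> against the sum of the indicators
  of the \<open>U i\<close>, derived from the nonnegativity of the quadratic polynomial
  \<open>quad\<close> in \<open>t\<close>.\<close>

lemma sum_measure_Int_squared_le:
  assumes "finite I" "H \<in> fmeasurable M" and U: "\<And>i. i \<in> I \<Longrightarrow> U i \<in> fmeasurable M"
  shows "(\<Sum>i\<in>I. measure M (H \<inter> U i))\<^sup>2 \<le> measure M H * (\<Sum>i\<in>I. \<Sum>j\<in>I. measure M (U i \<inter> U j))"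
proof -
  define S1 where "S1 = (\<Sum>i\<in>I. measure M (H \<inter> U i))"
  define S2 where "S2 = (\<Sum>i\<in>I. \<Sum>j\<in>I. measure M (U i \<inter> U j))"
  have hb: "has_bochner_integral M (indicator A :: _ \<Rightarrow> real) (measure M A)"
    if "A \<in> fmeasurable M" for A
    using that by (intro has_bochner_integral_real_indicator) (auto simp: fmeasurable_def)
  have UU: "U i \<inter> U j \<in> fmeasurable M" "H \<inter> U i \<in> fmeasurable M" if "i \<in> I" "j \<in> I" for i j
    using that assms by (auto intro: fmeasurable_Int_fmeasurable fmeasurableD)
  have quad: "0 \<le> S2 - 2 * t * S1 + t\<^sup>2 * measure M H" for t
  proof -
    define F where "F y = (\<Sum>i\<in>I. \<Sum>j\<in>I. indicator (U i \<inter> U j) y) - 2 * t * (\<Sum>i\<in>I. indicator (H \<inter> U i) y)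
        + t\<^sup>2 * (indicator H y :: real)" for y
    have F: "F y = ((\<Sum>i\<in>I. indicator (U i) y) - t * indicator H y)\<^sup>2" for y
    proof -
      have "((\<Sum>i\<in>I. indicator (U i) y) - t * indicator H y)\<^sup>2 =
        (\<Sum>i\<in>I. indicator (U i) y) * (\<Sum>i\<in>I. indicator (U i) y)
          - 2 * t * (indicator H y * (\<Sum>i\<in>I. indicator (U i) y)) + t\<^sup>2 * (indicator H y * indicator H y :: real)"
        by (simp add: power2_eq_square algebra_simps)
      also have "(\<Sum>i\<in>I. indicator (U i) y) * (\<Sum>i\<in>I. indicator (U i) y)
          = (\<Sum>i\<in>I. \<Sum>j\<in>I. indicator (U i \<inter> U j) y :: real)"
        by (simp only: sum_product indicator_inter_arith)
      also have "indicator H y * (\<Sum>i\<in>I. indicator (U i) y) = (\<Sum>i\<in>I. indicator (H \<inter> U i) y :: real)"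
        by (simp only: sum_distrib_left indicator_inter_arith)
      also have "indicator H y * indicator H y = (indicator H y :: real)"
        by (simp split: split_indicator)
      also have "(\<Sum>i\<in>I. \<Sum>j\<in>I. indicator (U i \<inter> U j) y) - 2 * t * (\<Sum>i\<in>I. indicator (H \<inter> U i) y)
        + t\<^sup>2 * indicator H y = F y" by (simp only: F_def)
      finally show ?thesis by simp
    qed
    have "has_bochner_integral M F (S2 - 2 * t * S1 + t\<^sup>2 * measure M H)"
      unfolding F_def S1_def S2_def
      by (intro has_bochner_integral_add has_bochner_integral_diff has_bochner_integral_mult_right
          has_bochner_integral_sum hb UU assms(2))
    then have "(\<integral>y. F y \<partial>M) = S2 - 2 * t * S1 + t\<^sup>2 * measure M H"
      by (rule has_bochner_integral_integral_eq)
    moreover have "(\<integral>y. F y \<partial>M) \<ge> 0" unfolding F by (intro Bochner_Integration.integral_nonneg) simp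
    ultimately show ?thesis by simp
  qed
  show ?thesis
  proof (cases "measure M H = 0")
    case True
    have "measure M (H \<inter> U i) = 0" if "i \<in> I" for i
      using measure_mono_fmeasurable[of "H \<inter> U i" H M] UU[OF that that] assms(2) True
      by (simp add: fmeasurableD measure_le_0_iff)
    then show ?thesis using True by simp
  next
    case False
    then have pos: "measure M H > 0" by (simp add: zero_less_measure_iff)
    \<comment> \<open>The minimiser of the quadratic is \<open>t = S1 / measure M H\<close>.\<close>
    have "0 \<le> S2 - 2 * (S1 / measure M H) * S1 + (S1 / measure M H)\<^sup>2 * measure M H" by (rule quad)
    then have "0 \<le> measure M H * (S2 - 2 * (S1 / measure M H) * S1 + (S1 / measure M H)\<^sup>2 * measure M H)"
      using pos by (intro mult_nonneg_nonneg) auto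
    also have "\<dots> = measure M H * S2 - S1\<^sup>2"
      using pos by (simp add: field_simps power2_eq_square)
    finally show ?thesis by (simp add: S1_def S2_def)
  qed
qed

text \<open>Weak form of the Lebesgue density theorem. Otherwise cover \<open>A\<close> by
  nonoverlapping intervals of total length at most \<open>(1 + \<eta>)\<close> times the measure of
  \<open>A\<close>; each has at most the proportion \<open>1 - \<eta>\<close> of its length in
  \<open>A\<close>, so \<open>measure lebesgue A\<close> would be at most
  \<open>1 - \<eta>\<^sup>2\<close> times itself.\<close>

lemma exists_interval_of_high_density:
  fixes l r :: real
  assumes A: "A \<in> lmeasurable" "A \<subseteq> {l..r}" "measure lebesgue A > 0" and "0 < \<eta>"
  obtains p q where "l \<le> p" "p < q" "q \<le> r" "measure lebesgue (A \<inter> {p<..<q}) \<ge> (1 - \<eta>) * (q - p)"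
proof (rule ccontr)
  note thesisI = that
  assume "\<not> thesis"
  then have low: "measure lebesgue (A \<inter> {p<..<q}) \<le> (1 - \<eta>) * (q - p)" if "l \<le> p" "p < q" "q \<le> r" for p q
    using that thesisI[of p q] by force
  have "l < r"
  proof (rule ccontr)
    assume "\<not> l < r"
    then have "A \<subseteq> {r}" using A(2) by auto
    then have "negligible A" by (rule negligible_subset[OF negligible_sing])
    then show False using A(3) negligible_imp_measure0 by fastforce
  qed
  have \<eta>1: "\<eta> \<le> 1"
    using low[of l r] \<open>l < r\<close> measure_nonneg[of lebesgue "A \<inter> {l<..<r}"]
    by (smt (verit) mult_neg_pos)
  define e where "e = \<eta> * measure lebesgue A"
  have "e > 0" using A \<open>0 < \<eta>\<close> by (simp add: e_def)
  have "A \<subseteq> cbox l r" using A(2) by simp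
  obtain \<D> where D: "countable \<D>"
    "\<And>K. K \<in> \<D> \<Longrightarrow> K \<subseteq> cbox l r \<and> K \<noteq> {} \<and> (\<exists>c d. K = cbox c d)"
    "pairwise (\<lambda>A B. interior A \<inter> interior B = {}) \<D>"
    and "\<And>u v. cbox u v \<in> \<D> \<Longrightarrow> \<exists>n. \<forall>i\<in>Basis. v \<bullet> i - u \<bullet> i = (r \<bullet> i - l \<bullet> i) / 2 ^ n"
    "\<And>K. K \<in> \<D> \<Longrightarrow> box l r \<noteq> {} \<Longrightarrow> interior K \<noteq> {}"
    and D': "A \<subseteq> \<Union>\<D>" "\<Union>\<D> \<in> lmeasurable" "measure lebesgue (\<Union>\<D>) \<le> measure lebesgue A + e"
    by (rule measurable_outer_intervals_bounded[OF A(1) \<open>A \<subseteq> cbox l r\<close> \<open>e > 0\<close>]) (rule that; assumption)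
  let ?O = "\<Union>(interior ` \<D>)"
  \<comment> \<open>Only the interiors of the covering intervals are disjoint. Passing to them loses
    the countably many endpoints, a null set.\<close>
  let ?N = "\<Union>((\<lambda>K. K - interior K) ` \<D>)"
  have null: "?N \<in> null_sets lebesgue"
  proof (intro null_sets_UN' D(1))
    fix K assume "K \<in> \<D>"
    then obtain c d where K: "K = {c..d}" using D(2)[of K] by auto
    have "K - interior K \<subseteq> {c, d}" by (auto simp: K interior_atLeastAtMost_real)
    then have "finite (K - interior K)" by (rule finite_subset) auto
    then show "K - interior K \<in> null_sets lebesgue" by (simp add: negligible_iff_null_sets[symmetric] negligible_finite)
  qed
  have disj: "disjoint_family_on interior \<D>"
    using D(3) by (auto simp: disjoint_family_on_def pairwise_def)
  have disjA: "disjoint_family_on (\<lambda>K. A \<inter> interior K) \<D>"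
    using disj by (auto simp: disjoint_family_on_def)
  have each: "emeasure lebesgue (A \<inter> interior K) \<le> ennreal (1 - \<eta>) * emeasure lebesgue (interior K)" if KD: "K \<in> \<D>" for K
  proof -
    obtain c d where K: "K = {c..d}" "K \<subseteq> {l..r}" using D(2)[OF KD] by auto
    have int: "interior K = {c<..<d}" by (simp add: K interior_atLeastAtMost_real)
    show ?thesis
    proof (cases "c < d")
      case True
      then have "l \<le> c" "d \<le> r" using K by auto
      then have "measure lebesgue (A \<inter> {c<..<d}) \<le> (1 - \<eta>) * (d - c)" using low True by blast
      moreover have "A \<inter> {c<..<d} \<in> lmeasurable" using A by (simp add: fmeasurable_Int_fmeasurable)
      ultimately show ?thesis using True \<eta>1
        unfolding int by (simp add: emeasure_eq_measure2 ennreal_mult[symmetric] ennreal_leI)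
    qed (simp add: int)
  qed
  have sets: "(\<Union>K\<in>\<D>. A \<inter> interior K) \<in> sets lebesgue"
    using D(1) A(1) by (intro sets.countable_UN'') (auto simp: fmeasurableD)
  have "A \<subseteq> (\<Union>K\<in>\<D>. A \<inter> interior K) \<union> ?N" using D'(1) by blast
  then have "emeasure lebesgue A \<le> emeasure lebesgue ((\<Union>K\<in>\<D>. A \<inter> interior K) \<union> ?N)"
    by (intro emeasure_mono sets.Un sets null_setsD2 null)
  also have "\<dots> = emeasure lebesgue (\<Union>K\<in>\<D>. A \<inter> interior K)"
    by (rule emeasure_Un_null_set[OF sets null])
  also have "\<dots> = (\<integral>\<^sup>+K. emeasure lebesgue (A \<inter> interior K) \<partial>count_space \<D>)"
    using D(1) A by (intro emeasure_UN_countable disjA) (auto simp: fmeasurableD)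
  also have "\<dots> \<le> (\<integral>\<^sup>+K. ennreal (1 - \<eta>) * emeasure lebesgue (interior K) \<partial>count_space \<D>)"
    by (intro nn_integral_mono) (use each in simp)
  also have "\<dots> = ennreal (1 - \<eta>) * (\<integral>\<^sup>+K. emeasure lebesgue (interior K) \<partial>count_space \<D>)"
    by (intro nn_integral_cmult) simp
  also have "(\<integral>\<^sup>+K. emeasure lebesgue (interior K) \<partial>count_space \<D>) = emeasure lebesgue ?O"
    using D(1) by (intro emeasure_UN_countable[symmetric] disj) auto
  also have "emeasure lebesgue ?O \<le> emeasure lebesgue (\<Union>\<D>)"
    using interior_subset by (intro emeasure_mono fmeasurableD D'(2)) auto
  also have "\<dots> \<le> ennreal (measure lebesgue A + e)"
    using D'(2,3) by (simp add: emeasure_eq_measure2 ennreal_leI)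
  finally have "ennreal (measure lebesgue A) \<le> ennreal (1 - \<eta>) * ennreal (measure lebesgue A + e)"
    using A(1) by (simp add: emeasure_eq_measure2 mult_left_mono)
  also have "\<dots> = ennreal ((1 - \<eta>) * (measure lebesgue A + e))"
    using \<eta>1 \<open>e > 0\<close> by (simp add: ennreal_mult)
  finally have "measure lebesgue A \<le> (1 - \<eta>) * (measure lebesgue A + e)"
    using \<eta>1 \<open>e > 0\<close> by (subst (asm) ennreal_le_iff) auto
  also have "\<dots> = measure lebesgue A * (1 - \<eta>\<^sup>2)" by (simp add: e_def power2_eq_square algebra_simps)
  finally have "measure lebesgue A * \<eta>\<^sup>2 \<le> 0" by (simp add: algebra_simps)
  moreover have "measure lebesgue A * \<eta>\<^sup>2 > 0" using A(3) \<open>0 < \<eta>\<close> by simp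
  ultimately show False by linarith
qed

section \<open>Points with a small multiple near an integer\<close>

text \<open>
  Outside this set two fractions \<open>b / k\<close>, \<open>b' / k'\<close> with \<open>0 < \<bar>k - k'\<bar> < m\<close> cannot both be very
  close to \<open>y\<close>, so each dyadic block sees at most one crossing.
\<close>

definition near_rational :: "nat \<Rightarrow> real \<Rightarrow> real set" where
  "near_rational m \<kappa> = {y. \<exists>e::nat. 1 \<le> e \<and> e < m \<and> (\<exists>f::int. \<bar>real e * y - f\<bar> < \<kappa>)}"

lemma open_near_rational: "open (near_rational m \<kappa>)"
proof -
  have "near_rational m \<kappa> = (\<Union>e\<in>{1..<m}. \<Union>f::int. {y. \<bar>real e * y - f\<bar> < \<kappa>})"
    by (auto simp: near_rational_def Bex_def) blast
  then show ?thesis by (auto intro!: open_UN open_Collect_less continuous_intros)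
qed

text \<open>For each \<open>e\<close> there are at most \<open>e * (z - x) + 2\<close> relevant
  integers \<open>f\<close>, each giving an interval of length \<open>2 * \<kappa> / e\<close>. The
  factor \<open>e\<close> cancels, so every \<open>e < m\<close> costs at most
  \<open>\<kappa> * (2 * (z - x) + 4)\<close>.\<close>

lemma measure_near_rational_le:
  assumes "x \<le> z" "0 < \<kappa>" "\<kappa> \<le> 1 / 2"
  shows "measure lebesgue (near_rational m \<kappa> \<inter> {x<..<z}) \<le> real m * \<kappa> * (2 * (z - x) + 4)"
proof -
  define F where "F e = {f :: int. real e * x - \<kappa> \<le> f \<and> f \<le> real e * z + \<kappa>}" for e :: nat
  have F: "finite (F e)" "real (card (F e)) \<le> real e * (z - x) + 2" for e
  proof -
    have "real e * x \<le> real e * z" using assms by (intro mult_left_mono) auto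
    then have "real e * x - \<kappa> \<le> real e * z + \<kappa> + 1" using assms by linarith
    from card_int_between[OF this] show "finite (F e)" "real (card (F e)) \<le> real e * (z - x) + 2"
      unfolding F_def using assms by (auto simp: algebra_simps)
  qed
  define I where "I e f = {(f - \<kappa>) / real e<..<(f + \<kappa>) / real e}" for e :: nat and f :: int
  have sub: "near_rational m \<kappa> \<inter> {x<..<z} \<subseteq> (\<Union>e\<in>{1..<m}. \<Union>f\<in>F e. I e f)"
  proof
    fix y assume y: "y \<in> near_rational m \<kappa> \<inter> {x<..<z}"
    then obtain e :: nat and f :: int where ef: "1 \<le> e" "e < m" "\<bar>real e * y - f\<bar> < \<kappa>"
      by (auto simp: near_rational_def)
    have "real e * x \<le> real e * y" "real e * y \<le> real e * z" using y by (auto intro!: mult_left_mono)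
    then have "real e * x - \<kappa> \<le> f" "f \<le> real e * z + \<kappa>" using ef(3) by linarith+
    then have "f \<in> F e" by (simp add: F_def)
    moreover have "y \<in> I e f" using ef by (auto simp: I_def field_simps)
    ultimately show "y \<in> (\<Union>e\<in>{1..<m}. \<Union>f\<in>F e. I e f)" using ef by force
  qed
  have "measure lebesgue (near_rational m \<kappa> \<inter> {x<..<z}) \<le> measure lebesgue (\<Union>e\<in>{1..<m}. \<Union>f\<in>F e. I e f)"
    using open_near_rational
    by (intro measure_mono_fmeasurable sub fmeasurable.finite_UN finite_atLeastLessThan F(1))
       (auto simp: I_def intro: borel_open)
  also have "\<dots> \<le> (\<Sum>e\<in>{1..<m}. measure lebesgue (\<Union>f\<in>F e. I e f))"
    using F(1) by (intro measure_UNION_le) (auto simp: I_def intro!: sets.finite_UN)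
  also have "\<dots> \<le> (\<Sum>e\<in>{1..<m}. \<Sum>f\<in>F e. measure lebesgue (I e f))"
    using F(1) by (intro sum_mono measure_UNION_le) (auto simp: I_def)
  also have "\<dots> = (\<Sum>e\<in>{1..<m}. real (card (F e)) * (2 * \<kappa> / e))"
  proof (intro sum.cong refl)
    fix e assume "e \<in> {1..<m}"
    have "measure lebesgue (I e f) = 2 * \<kappa> / e" for f
      using \<open>0 < \<kappa>\<close> by (simp add: I_def divide_right_mono diff_divide_distrib[symmetric])
    then show "(\<Sum>f\<in>F e. measure lebesgue (I e f)) = real (card (F e)) * (2 * \<kappa> / e)" by simp
  qed
  also have "\<dots> \<le> (\<Sum>e\<in>{1..<m}. \<kappa> * (2 * (z - x) + 4))"
  proof (intro sum_mono)
    fix e assume e: "e \<in> {1..<m}"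
    have "real (card (F e)) * (2 * \<kappa> / e) \<le> (real e * (z - x) + 2) * (2 * \<kappa> / e)"
      using F(2) assms by (intro mult_right_mono) auto
    also have "\<dots> = 2 * \<kappa> * (z - x) + 4 * \<kappa> / e" using e by (simp add: field_simps)
    also have "4 * \<kappa> / e \<le> 4 * \<kappa> / 1" using e assms by (intro divide_left_mono) auto
    finally show "real (card (F e)) * (2 * \<kappa> / e) \<le> \<kappa> * (2 * (z - x) + 4)" by (simp add: algebra_simps)
  qed
  also have "\<dots> = real (m - 1) * (\<kappa> * (2 * (z - x) + 4))" by simp
  also have "\<dots> \<le> real m * (\<kappa> * (2 * (z - x) + 4))"
    using assms by (intro mult_right_mono mult_nonneg_nonneg) auto
  finally show ?thesis by (simp add: mult.assoc)
qed

section \<open>How the walk changes when \<open>y\<close> crosses a fraction\<close>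

text \<open>The partial sums \<open>P k\<close> of the overview. The range is half-open: the term of
  index \<open>k\<close> first counts at \<open>k + 1\<close>, hence the condition
  \<open>k < i\<close> in \<open>walk_jump\<close>.\<close>

definition walk :: "(nat \<Rightarrow> int) \<Rightarrow> nat \<Rightarrow> real \<Rightarrow> nat \<Rightarrow> real" where
  "walk c s y k = (\<Sum>i\<in>{s..<k}. of_int (c (nat \<lfloor>real i * y\<rfloor>)))"

lemma floor_at_crossing:
  fixes y u :: real
  assumes "0 < k" "y < real b / real k" "real b / real k < y + u" "real k * u \<le> 1"
  shows "\<lfloor>real k * y\<rfloor> = int b - 1" "\<lfloor>real k * (y + u)\<rfloor> = int b"
proof -
  have 1: "real k * y < b" "b < real k * y + real k * u"
    using assms by (auto simp: field_simps)
  show "\<lfloor>real k * y\<rfloor> = int b - 1" using 1 assms(4) by (simp add: floor_eq_iff)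
  show "\<lfloor>real k * (y + u)\<rfloor> = int b" using 1 assms(4) by (simp add: floor_eq_iff distrib_left)
qed

text \<open>If index \<open>i\<close> also crossed an integer \<open>b'\<close>, both
  \<open>k * y\<close> and \<open>i * y\<close> would lie at most \<open>\<kappa>\<close> below the
  integers \<open>b\<close> and \<open>b'\<close>. Subtracting puts the multiple
  \<open>\<bar>i - k\<bar> * y\<close> within \<open>2 * \<kappa>\<close> of an integer, against
  \<open>y \<notin> near_rational m (2 * \<kappa>)\<close>.\<close>

lemma floor_off_crossing:
  fixes y u :: real
  assumes "0 < k" "y < real b / real k" "real b / real k < y + u" "0 < u"
    and "y \<notin> near_rational m (2 * \<kappa>)" and ku: "real k * u \<le> \<kappa>" "real i * u \<le> \<kappa>"
    and "i \<noteq> k" "i < k + m" "k < i + m"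
  shows "\<lfloor>real i * (y + u)\<rfloor> = \<lfloor>real i * y\<rfloor>"
proof (rule ccontr)
  assume ne: "\<not> ?thesis"
  define b' where "b' = \<lfloor>real i * (y + u)\<rfloor>"
  have "real i * y \<le> real i * (y + u)" using \<open>0 < u\<close> by (intro mult_left_mono) auto
  then have "\<lfloor>real i * y\<rfloor> < b'" using ne floor_mono[of "real i * y" "real i * (y + u)"] by (simp add: b'_def)
  then have b': "real i * y < b'" "b' \<le> real i * y + real i * u"
    by (auto simp: b'_def floor_less_iff distrib_left[symmetric])
  have b: "real k * y < b" "b < real k * y + real k * u" using assms by (auto simp: field_simps)
  show False
  proof (cases "k < i")
    case True
    have "\<bar>real (i - k) * y - of_int (b' - int b)\<bar> < 2 * \<kappa>"
      using True b b' ku by (simp add: of_nat_diff algebra_simps abs_less_iff)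
    moreover have "1 \<le> i - k" "i - k < m" using True assms by auto
    ultimately show False using assms(5) unfolding near_rational_def by blast
  next
    case False
    then have "i < k" using \<open>i \<noteq> k\<close> by simp
    have "\<bar>real (k - i) * y - of_int (int b - b')\<bar> < 2 * \<kappa>"
      using \<open>i < k\<close> b b' ku by (simp add: of_nat_diff algebra_simps abs_less_iff)
    moreover have "1 \<le> k - i" "k - i < m" using \<open>i < k\<close> assms by auto
    ultimately show False using assms(5) unfolding near_rational_def by blast
  qed
qed

text \<open>Inside the block only the \<open>k\<close>-th summand changes between \<open>y\<close>
  and \<open>y + u\<close>. The changes before \<open>v\<close> form a constant shift, which is the
  \<open>C\<close> of \<open>haar_jump\<close>.\<close>

lemma walk_jump:
  fixes y u :: real
  assumes "0 < k" "y < real b / real k" "real b / real k < y + u" "0 < u" "0 < y"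
    and "y \<notin> near_rational (2 * d) (2 * \<kappa>)" and \<kappa>: "\<kappa> \<le> 1" "\<And>i. i < v + 2 * d \<Longrightarrow> real i * u \<le> \<kappa>"
    and "s \<le> v" "v \<le> k" "k < v + 2 * d" and i: "v \<le> i" "i < v + 2 * d"
  shows "walk c s (y + u) i - walk c s y i
    = (walk c s (y + u) v - walk c s y v) + (if k < i then of_int (c b - c (b - 1)) else 0)"
proof -
  define x where "x j = (of_int (c (nat \<lfloor>real j * (y + u)\<rfloor>)) - of_int (c (nat \<lfloor>real j * y\<rfloor>)) :: real)" for j
  have diff: "walk c s (y + u) j - walk c s y j = sum x {s..<j}" for j
    by (simp add: walk_def x_def sum_subtractf)
  have "1 \<le> b"
    using assms by (metis One_nat_def Suc_leI div_0 gr0I less_trans not_less_iff_gr_or_eq of_nat_0)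
  have "real k * u \<le> \<kappa>" using assms by blast
  with \<kappa>(1) have "real k * u \<le> 1" by linarith
  then have at: "\<lfloor>real k * y\<rfloor> = int b - 1" "\<lfloor>real k * (y + u)\<rfloor> = int b"
    using floor_at_crossing[of k y b u] assms by auto
  have "nat (int b - 1) = b - 1" by simp
  with at have xk: "x k = of_int (c b - c (b - 1))" by (simp add: x_def)
  have x0: "x j = 0" if "v \<le> j" "j < v + 2 * d" "j \<noteq> k" for j
    using floor_off_crossing[of k y b u "2 * d" \<kappa> j] assms that by (auto simp: x_def)
  have "sum x {s..<i} = sum x {s..<v} + sum x {v..<i}"
    using i \<open>s \<le> v\<close> by (simp add: sum.atLeastLessThan_concat)
  also have "sum x {v..<i} = (if k < i then x k else 0)"
  proof -
    have "sum x {v..<i} = (\<Sum>j\<in>{v..<i}. if j = k then x k else 0)"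
      using i by (intro sum.cong) (auto intro: x0)
    also have "\<dots> = (if k < i then x k else 0)" using \<open>v \<le> k\<close> by simp
    finally show ?thesis .
  qed
  finally show ?thesis unfolding diff xk .
qed

text \<open>A second crossing at \<open>k' \<noteq> k\<close> would change a floor that
  \<open>floor_off_crossing\<close> keeps fixed; once \<open>k = k'\<close>, the floor at
  \<open>y + u\<close> determines \<open>b\<close>.\<close>

lemma crossing_unique:
  fixes y u :: real
  assumes "0 < k" "y < real b / real k" "real b / real k < y + u"
    and "0 < k'" "y < real b' / real k'" "real b' / real k' < y + u" "0 < u"
    and "y \<notin> near_rational m (2 * \<kappa>)" "\<kappa> \<le> 1" "real k * u \<le> \<kappa>" "real k' * u \<le> \<kappa>"
    and "k < k' + m" "k' < k + m"
  shows "b = b' \<and> k = k'"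
proof -
  have f: "\<lfloor>real k' * y\<rfloor> = int b' - 1" "\<lfloor>real k' * (y + u)\<rfloor> = int b'"
    using floor_at_crossing[of k' y b' u] assms by auto
  have "k = k'"
  proof (rule ccontr)
    assume "k \<noteq> k'"
    then have "\<lfloor>real k' * (y + u)\<rfloor> = \<lfloor>real k' * y\<rfloor>"
      using floor_off_crossing[of k y b u m \<kappa> k'] assms by auto
    with f show False by simp
  qed
  moreover have "\<lfloor>real k * (y + u)\<rfloor> = int b" using floor_at_crossing[of k y b u] assms by auto
  ultimately show ?thesis using f by simp
qed

lemma borel_measurable_term: "(\<lambda>y. real_of_int (c (nat \<lfloor>real i * y\<rfloor>))) \<in> borel_measurable borel"
proof -
  have "(\<lambda>y. \<lfloor>real i * y\<rfloor>) \<in> measurable borel (count_space UNIV)" by measurable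
  then show ?thesis by (rule measurable_compose) simp
qed

lemma borel_measurable_walk: "(\<lambda>y. walk c s y k) \<in> borel_measurable borel"
  unfolding walk_def by (intro borel_measurable_sum borel_measurable_term)

lemma borel_measurable_haar_walk: "(\<lambda>y. haar (walk c s y) v d) \<in> borel_measurable borel"
  unfolding haar_def by (intro borel_measurable_sum borel_measurable_diff borel_measurable_walk)

lemma less_add_of_div_eq:
  fixes x y m :: nat
  assumes "x div m = y div m" "0 < m"
  shows "x < y + m"
proof -
  have "x = y div m * m + x mod m" unfolding assms(1)[symmetric] by (rule div_mult_mod_eq[symmetric])
  also have "\<dots> < y div m * m + m" using assms(2) by simp
  also have "\<dots> \<le> y + m" by (simp add: div_times_less_eq_dividend)
  finally show ?thesis .
qed

section \<open>One dyadic length: second moment and large Haar coefficients\<close>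

text \<open>
  One dyadic length \<open>2d\<close> at scale \<open>s\<close>: \<open>S\<close> is the set of jumps, \<open>u\<close> the radius of the neighbourhoods
  of the fractions. \<open>N\<close> and \<open>Q\<close> serve Dirichlet's theorem: pairs \<open>(b, b')\<close> for which \<open>b' / b\<close> has a
  \<open>1 / N\<close>-good approximation with denominator at most \<open>Q\<close> are counted trivially, being few.
\<close>

locale crossing_scale =
  fixes A :: "real set" and S :: "nat set" and p q q0 u :: real and s d N Q :: nat
  assumes p: "1 \<le> p" "p < q" "q \<le> q0" "2 * q \<le> 3 * p"
    and s: "s > 0" and d: "d > 0" "even d" "2 * d dvd s" and N: "N > 0"
    and S: "\<And>b. b \<in> S \<Longrightarrow> 3 / 2 * p * s \<le> b \<and> b < 2 * p * s"
    and A: "A \<in> lmeasurable" and u: "0 < u"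
    and d_small: "2 * q0 * (1 + d) \<le> s * (q - p)"
    and u_small: "16 * s * u < 1"
    and N_small: "real N \<le> s * (q - p)"
    and Q_large: "1 \<le> 8 * s * u * Q"
    and S_large: "3 * (real Q * (2 * real Q + 1) * (4 * q0 * s / N + 1)) \<le> 160 * s * u * card S"
    and A_dense: "measure lebesgue ({p - u<..<q + u} - (A - near_rational (2 * d) (4 * s * u)))
      \<le> (q - p) / (10240 * q0\<^sup>2)"
begin

text \<open>These are the \<open>k\<close> with \<open>p < b / k < q\<close>, solved for
  \<open>k\<close> so that \<open>K b\<close> is visibly an interval of integers.\<close>

definition K :: "nat \<Rightarrow> nat set" where
  "K b = {k. real b / q < k \<and> k < real b / p}"

definition pairs :: "(nat \<times> nat) set" where
  "pairs = Sigma S (\<lambda>b. {k \<in> K b. central d k})"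

definition nbhd :: "nat \<times> nat \<Rightarrow> real set" where
  "nbhd = (\<lambda>(b, k). {real b / k - u<..<real b / k + u})"

lemma q0: "1 \<le> q0" using p by linarith

lemma len_nonneg: "0 \<le> s * (q - p)" using p by simp

lemma finite_S: "finite S"
proof (rule finite_subset)
  show "S \<subseteq> {..nat \<lceil>2 * p * s\<rceil>}"
  proof
    fix b assume "b \<in> S"
    then have "real b < 2 * p * s" using S by blast
    then show "b \<in> {..nat \<lceil>2 * p * s\<rceil>}" unfolding atMost_iff by linarith
  qed
qed simp

lemma S_bounds:
  assumes "b \<in> S"
  shows "real s \<le> b" "real b < 2 * q0 * s" "0 < b"
proof -
  have "1 * real s \<le> 3 / 2 * p * s" using p by (intro mult_right_mono) auto
  then show 1: "real s \<le> b" using S[OF assms] by linarith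
  have "2 * p * s \<le> 2 * q0 * s" using p by (intro mult_right_mono) auto
  then show "real b < 2 * q0 * s" using S[OF assms] by linarith
  show "0 < b" using 1 s by linarith
qed

text \<open>The window for \<open>b\<close> is chosen for this: \<open>b / p < 2 * s\<close>, and
  \<open>2 * q \<le> 3 * p\<close> gives \<open>b / q \<ge> s\<close>.\<close>

lemma K_bounds:
  assumes "b \<in> S" "k \<in> K b"
  shows "s \<le> k" "k < 2 * s" "p < real b / k" "real b / k < q"
proof -
  have k: "real b / q < k" "k < real b / p" using assms by (auto simp: K_def)
  have "0 \<le> real b / q" using p by simp
  then have k0: "0 < real k" using k by linarith
  have "real s * q \<le> 3 / 2 * p * s" using p(4) s by simp
  then have "real s * q \<le> b" using S[OF assms(1)] by linarith
  then have "real s \<le> b / q" using p by (simp add: field_simps)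
  then show "s \<le> k" using k by linarith
  have "real b / p < 2 * s" using S[OF assms(1)] p by (simp add: field_simps)
  then show "k < 2 * s" using k by linarith
  show "p < real b / k" using k(2) k0 p by (simp add: field_simps)
  show "real b / k < q" using k(1) k0 p by (simp add: field_simps)
qed

text \<open>The real interval has length \<open>b * (q - p) / (p * q)\<close>, between
  \<open>3 / 2 * (s * (q - p)) / q0\<close> and \<open>2 * (s * (q - p))\<close>. Rounding costs at
  most \<open>1\<close>, which is at most \<open>s * (q - p)\<close> by
  \<open>N_small\<close>.\<close>

lemma K_interval:
  assumes "b \<in> S"
  obtains l len where "K b = {l..<l + len}" "3 / 2 * (s * (q - p)) / q0 - 1 \<le> len" "len \<le> 3 * (s * (q - p))"
proof -
  define x where "x = real b / q"
  define y where "y = real b / p"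
  define l where "l = nat (\<lfloor>x\<rfloor> + 1)"
  define len where "len = nat \<lceil>y\<rceil> - l"
  have b: "0 < b" using S_bounds[OF assms] by simp
  have x0: "0 \<le> x" using p by (simp add: x_def)
  have "x < y" using p b by (simp add: x_def y_def frac_less2)
  then have le: "l \<le> nat \<lceil>y\<rceil>" unfolding l_def using x0 by linarith
  have "K b = {l..<l + len}"
    using le nat_open_interval_eq[OF x0, of y] by (simp add: K_def len_def l_def x_def y_def)
  moreover have len: "y - x - 1 \<le> len" "len \<le> y - x + 1"
    unfolding len_def using le x0 unfolding l_def by (simp_all add: of_nat_diff) linarith+
  have yx: "y - x = b * (q - p) / (p * q)"
    using p by (simp add: x_def y_def field_simps)
  have "3 / 2 * (s * (q - p)) / q0 \<le> y - x"
  proof -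
    have "3 / 2 * (s * (q - p)) / q0 \<le> 3 / 2 * (s * (q - p)) / q"
      using p len_nonneg by (intro divide_left_mono) auto
    also have "\<dots> = (3 / 2 * p * s) * (q - p) / (p * q)" using p by (simp add: field_simps)
    also have "\<dots> \<le> y - x" unfolding yx
      using p S[OF assms] by (intro divide_right_mono mult_right_mono) auto
    finally show ?thesis .
  qed
  moreover have "y - x \<le> 2 * (s * (q - p))"
  proof -
    have "y - x \<le> (2 * p * s) * (q - p) / (p * q)" unfolding yx
      using p S[OF assms] by (intro divide_right_mono mult_right_mono) auto
    also have "\<dots> = 2 * (s * (q - p)) / q" using p by (simp add: field_simps)
    also have "\<dots> \<le> 2 * (s * (q - p)) / 1" using p len_nonneg by (intro divide_left_mono) auto
    finally show ?thesis by simp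
  qed
  moreover have "1 \<le> s * (q - p)" using N_small N by linarith
  ultimately show ?thesis using that[of l len] len by linarith
qed

lemma finite_K: "b \<in> S \<Longrightarrow> finite (K b)"
  by (metis K_interval finite_atLeastLessThan)

lemma finite_pairs: "finite pairs"
  unfolding pairs_def using finite_S finite_K by auto

text \<open>About half of each \<open>K b\<close> is central. With
  \<open>x = s * (q - p) / (2 * q0)\<close> the length is at least \<open>3 * x - 1\<close>, and
  \<open>d_small\<close> bounds the losses \<open>1 + d\<close> by \<open>x\<close>.\<close>

lemma card_pairs: "card S * (s * (q - p)) / (2 * q0) \<le> card pairs"
proof -
  have each: "s * (q - p) / (2 * q0) \<le> card {k \<in> K b. central d k}" if b: "b \<in> S" for b
  proof -
    obtain l len where K: "K b = {l..<l + len}" "3 / 2 * (s * (q - p)) / q0 - 1 \<le> len"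
      using K_interval[OF b] by metis
    have "l + len \<le> l + d + 2 * card {k \<in> K b. central d k}"
      unfolding K using card_central[OF d(1), of "l + len" l] by simp
    then have "real len \<le> d + 2 * real (card {k \<in> K b. central d k})" by linarith
    moreover have "1 + real d \<le> s * (q - p) / (2 * q0)" using d_small q0 by (simp add: field_simps)
    moreover have "3 / 2 * (s * (q - p)) / q0 = 3 * (s * (q - p) / (2 * q0))" by simp
    ultimately show ?thesis using K(2) by linarith
  qed
  have "card pairs = (\<Sum>b\<in>S. card {k \<in> K b. central d k})"
    unfolding pairs_def using finite_S finite_K by (intro card_SigmaI) auto
  then have "real (card pairs) = (\<Sum>b\<in>S. real (card {k \<in> K b. central d k}))" by simp
  also have "\<dots> \<ge> (\<Sum>b\<in>S. s * (q - p) / (2 * q0))" by (intro sum_mono each)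
  finally show ?thesis by simp
qed

text \<open>Number of overlapping neighbourhoods for \<open>b\<close> and \<open>b'\<close>. Here
  \<open>k\<close> runs over all of \<open>K b\<close>, an interval, as
  \<open>card_near_integer\<close> requires.\<close>

definition T :: "nat \<Rightarrow> nat \<Rightarrow> nat" where
  "T b b' = card {kk \<in> K b \<times> K b'. \<bar>real b / fst kk - real b' / snd kk\<bar> < 2 * u}"

text \<open>Multiplying the distance of the two fractions by \<open>k * k' / b \<le> 4 * s\<close>
  puts \<open>k * b' / b\<close> within \<open>8 * s * u\<close> of \<open>k'\<close>. As
  \<open>8 * s * u < 1 / 2\<close>, the index \<open>k\<close> determines \<open>k'\<close>.\<close>

lemma T_le:
  assumes b: "b \<in> S" "b' \<in> S"
  shows "T b b' \<le> card {k \<in> K b. \<exists>f::int. \<bar>real k * (real b' / real b) - f\<bar> \<le> 8 * s * u}"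
proof -
  let ?X = "{kk \<in> K b \<times> K b'. \<bar>real b / fst kk - real b' / snd kk\<bar> < 2 * u}"
  have near: "\<bar>real k * (real b' / real b) - k'\<bar> < 8 * s * u" if "(k, k') \<in> ?X" for k k'
  proof -
    have k: "k \<in> K b" "k' \<in> K b'" "\<bar>real b / k - real b' / k'\<bar> < 2 * u" using that by auto
    have bd: "s \<le> k" "k < 2 * s" "s \<le> k'" "k' < 2 * s" using K_bounds b k by auto
    then have pos: "0 < real k" "0 < real k'" using s by linarith+
    have b0: "0 < real b" "real s \<le> b" using S_bounds[OF b(1)] by auto
    have "real k * (real b' / real b) - k' = (real k * k' / b) * (real b' / k' - real b / k)"
      using pos b0 by (simp add: field_simps)
    then have "\<bar>real k * (real b' / real b) - k'\<bar> = (real k * k' / b) * \<bar>real b / k - real b' / k'\<bar>"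
      using pos b0 by (simp add: abs_mult abs_minus_commute)
    also have "\<dots> < (real k * k' / b) * (2 * u)"
      using k pos b0 by (intro mult_strict_left_mono) auto
    also have "\<dots> \<le> (2 * s * (2 * s) / s) * (2 * u)"
    proof -
      have "real k * real k' \<le> real (2 * s) * real (2 * s)" using bd by (intro mult_mono) auto
      then have "real k * real k' \<le> real (2 * s * (2 * s))" by simp
      then show ?thesis using b0 u s by (intro mult_right_mono frac_le) auto
    qed
    also have "\<dots> = 8 * s * u" using s by simp
    finally show ?thesis .
  qed
  have "inj_on fst ?X"
  proof (rule inj_onI)
    fix x y assume x: "x \<in> ?X" and y: "y \<in> ?X" and e: "fst x = fst y"
    have "\<bar>real (fst x) * (real b' / real b) - snd x\<bar> < 8 * s * u"
      "\<bar>real (fst x) * (real b' / real b) - snd y\<bar> < 8 * s * u"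
      using near[of "fst x" "snd x"] near[of "fst y" "snd y"] x y e by auto
    then have "\<bar>real (snd x) - real (snd y)\<bar> < 1" using u_small by linarith
    then show "x = y" using e by (auto simp: prod_eq_iff)
  qed
  then have "T b b' = card (fst ` ?X)" by (simp add: T_def card_image)
  also have "\<dots> \<le> card {k \<in> K b. \<exists>f::int. \<bar>real k * (real b' / real b) - f\<bar> \<le> 8 * s * u}"
  proof (rule card_mono)
    show "fst ` ?X \<subseteq> {k \<in> K b. \<exists>f::int. \<bar>real k * (real b' / real b) - f\<bar> \<le> 8 * s * u}"
    proof
      fix k assume "k \<in> fst ` ?X"
      then obtain k' where k': "(k, k') \<in> ?X" by (metis (no_types, lifting) imageE prod.collapse)
      then have "\<bar>real k * (real b' / real b) - of_int (int k')\<bar> \<le> 8 * s * u" using near[OF k'] by simp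
      then show "k \<in> {k \<in> K b. \<exists>f::int. \<bar>real k * (real b' / real b) - f\<bar> \<le> 8 * s * u}" using k' by blast
    qed
  qed (use finite_K[OF b(1)] in auto)
  finally show ?thesis .
qed

text \<open>For fixed \<open>b\<close>, the \<open>b'\<close> in the exceptional set
  \<open>E\<close> get the trivial bound \<open>card (K b)\<close> and are few by
  \<open>S_large\<close>. All others satisfy the hypothesis of \<open>card_near_integer\<close> with
  \<open>\<epsilon> = 8 * s * u\<close>, because \<open>Q_large\<close> says
  \<open>1 / \<epsilon> \<le> Q\<close>.\<close>

lemma sum_T_le: "(\<Sum>b\<in>S. \<Sum>b'\<in>S. real (T b b')) \<le> 320 * (real (card S))\<^sup>2 * u * s * (s * (q - p))"
proof -
  define L where "L = s * (q - p)"
  define X where "X = real Q * (2 * real Q + 1) * (4 * q0 * s / N + 1)"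
  have L0: "0 \<le> L" using len_nonneg by (simp add: L_def)
  have row: "(\<Sum>b'\<in>S. real (T b b')) \<le> card S * (320 * u * s * L)" if b: "b \<in> S" for b
  proof -
    obtain l len where K: "K b = {l..<l + len}" "len \<le> 3 * L"
      using K_interval[OF b] unfolding L_def by metis
    define E where "E = {b'. b' \<le> 2 * b \<and> (\<exists>q::nat. 1 \<le> q \<and> q \<le> Q \<and> (\<exists>p::int. \<bar>real q * (real b' / real b) - p\<bar> < 1 / N))}"
    have b0: "0 < b" "real b < 2 * q0 * s" using S_bounds[OF b] by auto
    have E: "finite E" "real (card E) \<le> X"
    proof -
      show "finite E" unfolding E_def by (rule card_well_approximable(1)[OF b0(1) N])
      have "real (card E) \<le> real Q * (2 * real Q + 1) * (2 * real b / N + 1)"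
        unfolding E_def by (rule card_well_approximable(2)[OF b0(1) N])
      also have "\<dots> \<le> X" unfolding X_def using b0
        by (intro mult_left_mono add_right_mono divide_right_mono) auto
      finally show "real (card E) \<le> X" .
    qed
    have exc: "real (T b b') \<le> 3 * L" if "b' \<in> S" for b'
    proof -
      have "T b b' \<le> card {k \<in> K b. \<exists>f::int. \<bar>real k * (real b' / real b) - f\<bar> \<le> 8 * s * u}"
        by (rule T_le[OF b that])
      also have "\<dots> \<le> card (K b)" by (rule card_mono[OF finite_K[OF b]]) simp
      finally show ?thesis using K by simp
    qed
    have gen: "real (T b b') \<le> 160 * u * s * L" if b': "b' \<in> S" "b' \<notin> E" for b'
    proof -
      \<comment> \<open>The window gives \<open>b' < 2 * p * s\<close> and
        \<open>3 / 2 * p * s \<le> b\<close>.\<close>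
      have "real b' \<le> 2 * b" using S[OF b] S[OF b'(1)] by simp
      then have "b' \<le> 2 * b" by simp
      have no: "\<bar>real q * (real b' / real b) - p\<bar> \<ge> 1 / real N"
        if "1 \<le> q" "real q \<le> 1 / (8 * s * u)" for q :: nat and p :: int
      proof -
        have "1 / (8 * s * u) \<le> Q" using Q_large s u by (simp add: field_simps)
        then have "real q \<le> Q" using that(2) by linarith
        then have "q \<le> Q" by simp
        show ?thesis
        proof (rule ccontr)
          assume "\<not> ?thesis"
          then have "\<bar>real q * (real b' / real b) - p\<bar> < 1 / N" by simp
          then have "b' \<in> E" using \<open>q \<le> Q\<close> \<open>b' \<le> 2 * b\<close> that(1) unfolding E_def by blast
          then show False using b'(2) by contradiction
        qed
      qed
      have "real (T b b') \<le> real (card {k \<in> {l..<l + len}. \<exists>f::int. \<bar>real k * (real b' / real b) - f\<bar> \<le> 8 * s * u})"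
        unfolding of_nat_le_iff K(1)[symmetric] by (rule T_le[OF b b'(1)])
      also have "\<dots> \<le> 5 * (8 * s * u) * (real len + real N)"
        using s u by (intro card_near_integer N no) auto
      also have "\<dots> \<le> 5 * (8 * s * u) * (3 * L + L)"
        using K(2) N_small u by (intro mult_left_mono) (auto simp: L_def)
      finally show ?thesis by (simp add: algebra_simps)
    qed
    have "(\<Sum>b'\<in>S. real (T b b')) \<le> (\<Sum>b'\<in>S. 160 * u * s * L + (if b' \<in> E then 3 * L else 0))"
    proof (intro sum_mono)
      fix b' assume b': "b' \<in> S"
      have "0 \<le> 160 * u * s * L" using u L0 by simp
      then show "real (T b b') \<le> 160 * u * s * L + (if b' \<in> E then 3 * L else 0)"
        using exc[OF b'] gen[OF b'] by (cases "b' \<in> E"; simp only: if_True if_False; linarith)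
    qed
    also have "\<dots> = card S * (160 * u * s * L) + real (card (S \<inter> E)) * (3 * L)"
      using finite_S by (simp add: sum.distrib sum.inter_restrict[symmetric])
    also have "real (card (S \<inter> E)) * (3 * L) \<le> X * (3 * L)"
    proof -
      have "card (S \<inter> E) \<le> card E" using E by (intro card_mono) auto
      then show ?thesis using E L0 by (intro mult_right_mono) auto
    qed
    also have "X * (3 * L) = 3 * X * L" by simp
    also have "3 * X * L \<le> (160 * s * u * card S) * L"
      using S_large L0 by (intro mult_right_mono) (auto simp: X_def)
    finally show ?thesis by (simp add: algebra_simps)
  qed
  have "(\<Sum>b\<in>S. \<Sum>b'\<in>S. real (T b b')) \<le> (\<Sum>b\<in>S. card S * (320 * u * s * L))" by (intro sum_mono row)
  then show ?thesis by (simp add: L_def power2_eq_square algebra_simps)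
qed

text \<open>Second moment of the number of neighbourhoods containing a point: two of them meet only
  if their centres are less than \<open>2 * u\<close> apart, and then in measure at most
  \<open>2 * u\<close>.\<close>

lemma sum_overlap_le:
  "(\<Sum>x\<in>pairs. \<Sum>y\<in>pairs. measure lebesgue (nbhd x \<inter> nbhd y))
    \<le> 640 * (u * card S * s)\<^sup>2 * (q - p)"
proof -
  define C where "C b = {k \<in> K b. central d k}" for b
  have split_pairs: "(\<Sum>x\<in>pairs. g x) = (\<Sum>b\<in>S. \<Sum>k\<in>C b. g (b, k))" for g :: "nat \<times> nat \<Rightarrow> real"
    unfolding pairs_def C_def using finite_S finite_K by (subst sum.Sigma) auto
  have pair: "measure lebesgue (nbhd (b, k) \<inter> nbhd (b', k'))
      \<le> 2 * u * of_bool (\<bar>real b / k - real b' / k'\<bar> < 2 * u)" for b k b' k'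
  proof (cases "\<bar>real b / k - real b' / k'\<bar> < 2 * u")
    case True
    have "measure lebesgue (nbhd (b, k) \<inter> nbhd (b', k')) \<le> measure lebesgue (nbhd (b, k))"
      by (intro measure_mono_fmeasurable) (auto simp: nbhd_def)
    also have "\<dots> = 2 * u" using u by (simp add: nbhd_def)
    finally show ?thesis using True by simp
  next
    case False
    then have "nbhd (b, k) \<inter> nbhd (b', k') = {}" by (auto simp: nbhd_def)
    then show ?thesis using False by simp
  qed
  have inner: "(\<Sum>k\<in>C b. \<Sum>k'\<in>C b'. measure lebesgue (nbhd (b, k) \<inter> nbhd (b', k'))) \<le> 2 * u * T b b'"
    if b: "b \<in> S" "b' \<in> S" for b b'
  proof -
    have fin: "finite (K b)" "finite (K b')" using finite_K b by auto
    have "(\<Sum>k\<in>C b. \<Sum>k'\<in>C b'. measure lebesgue (nbhd (b, k) \<inter> nbhd (b', k')))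
      \<le> (\<Sum>k\<in>C b. \<Sum>k'\<in>C b'. 2 * u * of_bool (\<bar>real b / k - real b' / k'\<bar> < 2 * u))"
      by (intro sum_mono pair)
    also have "\<dots> = (\<Sum>kk\<in>C b \<times> C b'. 2 * u * of_bool (\<bar>real b / fst kk - real b' / snd kk\<bar> < 2 * u))"
      by (simp add: sum.cartesian_product case_prod_unfold)
    also have "\<dots> \<le> (\<Sum>kk\<in>K b \<times> K b'. 2 * u * of_bool (\<bar>real b / fst kk - real b' / snd kk\<bar> < 2 * u))"
      using fin u by (intro sum_mono2) (auto simp: C_def)
    also have "\<dots> = 2 * u * (\<Sum>kk\<in>K b \<times> K b'. of_bool (\<bar>real b / fst kk - real b' / snd kk\<bar> < 2 * u))"
      by (simp only: sum_distrib_left)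
    also have "(\<Sum>kk\<in>K b \<times> K b'. of_bool (\<bar>real b / fst kk - real b' / snd kk\<bar> < 2 * u)) = real (T b b')"
    proof -
      have "{x \<in> K b \<times> K b'. \<bar>real b / fst x - real b' / snd x\<bar> < 2 * u}
        = (K b \<times> K b') \<inter> {x. \<bar>real b / fst x - real b' / snd x\<bar> < 2 * u}" by auto
      then show ?thesis using fin by (simp add: T_def)
    qed
    finally show ?thesis .
  qed
  have "(\<Sum>x\<in>pairs. \<Sum>y\<in>pairs. measure lebesgue (nbhd x \<inter> nbhd y))
      = (\<Sum>b\<in>S. \<Sum>k\<in>C b. \<Sum>b'\<in>S. \<Sum>k'\<in>C b'. measure lebesgue (nbhd (b, k) \<inter> nbhd (b', k')))"
    by (simp only: split_pairs)
  also have "\<dots> = (\<Sum>b\<in>S. \<Sum>b'\<in>S. \<Sum>k\<in>C b. \<Sum>k'\<in>C b'. measure lebesgue (nbhd (b, k) \<inter> nbhd (b', k')))"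
    by (intro sum.cong refl sum.swap)
  also have "\<dots> \<le> (\<Sum>b\<in>S. \<Sum>b'\<in>S. 2 * u * T b b')" by (intro sum_mono inner)
  also have "\<dots> = 2 * u * (\<Sum>b\<in>S. \<Sum>b'\<in>S. real (T b b'))" by (simp add: sum_distrib_left)
  also have "\<dots> \<le> 2 * u * (320 * (real (card S))\<^sup>2 * u * s * (s * (q - p)))"
    using u by (intro mult_left_mono sum_T_le) auto
  finally show ?thesis by (simp add: power2_eq_square algebra_simps)
qed

text \<open>The bad set measured by \<open>A_dense\<close>. The margin \<open>u\<close> makes the
  interval contain every neighbourhood of a fraction in \<open>(p, q)\<close>.\<close>

definition H :: "real set" where
  "H = {p - u<..<q + u} - (A - near_rational (2 * d) (4 * s * u))"

lemma H_lmeasurable: "H \<in> lmeasurable"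
proof (rule fmeasurableI2)
  show "{p - u<..<q + u} \<in> lmeasurable" by simp
  have "near_rational (2 * d) (4 * s * u) \<in> sets lebesgue" using open_near_rational by simp
  then show "H \<in> sets lebesgue" unfolding H_def using A by (intro sets.Diff) (auto simp: fmeasurableD)
qed (auto simp: H_def)

text \<open>Cauchy-Schwarz with the second moment bound. The constant in \<open>A_dense\<close> is
  chosen so that \<open>640 / 10240 = (1 / 4)\<^sup>2\<close>; the bad part is then at most half of
  the lower bound for \<open>u * card pairs\<close>.\<close>

lemma sum_H_nbhd_le: "(\<Sum>x\<in>pairs. measure lebesgue (H \<inter> nbhd x)) \<le> u * card S * (s * (q - p)) / (4 * q0)"
proof -
  have "(\<Sum>x\<in>pairs. measure lebesgue (H \<inter> nbhd x))\<^sup>2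
      \<le> measure lebesgue H * (\<Sum>x\<in>pairs. \<Sum>y\<in>pairs. measure lebesgue (nbhd x \<inter> nbhd y))"
    by (intro sum_measure_Int_squared_le finite_pairs H_lmeasurable) (auto simp: nbhd_def split: prod.splits)
  also have "\<dots> \<le> (q - p) / (10240 * q0\<^sup>2) * (640 * (u * card S * s)\<^sup>2 * (q - p))"
    using A_dense sum_overlap_le p by (intro mult_mono) (auto simp: H_def intro!: sum_nonneg)
  also have "\<dots> = (u * card S * (s * (q - p)) / (4 * q0))\<^sup>2"
    using q0 by (simp add: power2_eq_square field_simps)
  finally show ?thesis
    by (rule power2_le_imp_le) (use u p q0 in simp)
qed

text \<open>Good starting points for the crossing of \<open>b / k\<close>: both \<open>y\<close> and
  \<open>y + u\<close> belong to \<open>A\<close>, and no second index of the same block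
  crosses.\<close>

definition W :: "nat \<times> nat \<Rightarrow> real set" where
  "W = (\<lambda>(b, k). {y. real b / k - u < y \<and> y < real b / k \<and> y \<in> A \<and> y \<notin> near_rational (2 * d) (4 * s * u) \<and> y + u \<in> A})"

lemma W_lmeasurable: "W x \<in> lmeasurable"
proof -
  obtain b k where x: "x = (b, k)" by force
  have eq: "W x = ({real b / k - u<..<real b / k} \<inter> A) \<inter> ((\<lambda>y. y - u) ` A - near_rational (2 * d) (4 * s * u))"
    by (auto simp: W_def x image_iff algebra_simps)
  have "(\<lambda>y. y - u) ` A \<in> lmeasurable" using A by (rule measurable_translation_subtract)
  then show ?thesis unfolding eq using A open_near_rational
    by (intro fmeasurable_Int_fmeasurable sets.Diff) (auto simp: fmeasurableD)
qed

text \<open>A point \<open>y\<close> of the left half of the neighbourhood is lost only if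
  \<open>y \<in> H\<close> or \<open>y + u \<in> H\<close>. These conditions concern disjoint halves
  of the neighbourhood, so the total loss is at most the measure of \<open>H\<close> inside
  it.\<close>

lemma measure_W_ge:
  assumes "(b, k) \<in> pairs"
  shows "u - measure lebesgue (H \<inter> nbhd (b, k)) \<le> measure lebesgue (W (b, k))"
proof -
  define z where "z = real b / k"
  have z: "p < z" "z < q" using assms K_bounds by (auto simp: pairs_def z_def)
  define H1 where "H1 = H \<inter> {z - u<..<z}"
  define H2 where "H2 = H \<inter> {z<..<z + u}"
  have fm: "H1 \<in> lmeasurable" "H2 \<in> lmeasurable" "(\<lambda>y. y - u) ` H2 \<in> lmeasurable"
    unfolding H1_def H2_def using H_lmeasurable
    by (auto intro!: fmeasurable_Int_fmeasurable measurable_translation_subtract)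
  have sub: "{z - u<..<z} \<subseteq> W (b, k) \<union> (H1 \<union> (\<lambda>y. y - u) ` H2)"
  proof
    fix y assume y: "y \<in> {z - u<..<z}"
    show "y \<in> W (b, k) \<union> (H1 \<union> (\<lambda>y. y - u) ` H2)"
    proof (cases "y \<in> H \<or> y + u \<in> H")
      case True
      then show ?thesis
      proof
        assume "y + u \<in> H"
        then have "y + u \<in> H2" using y by (auto simp: H2_def)
        then have "y \<in> (\<lambda>y. y - u) ` H2" by (force simp: image_iff)
        then show ?thesis by simp
      qed (use y in \<open>auto simp: H1_def\<close>)
    next
      case False
      then show ?thesis using y z by (auto simp: W_def H_def z_def)
    qed
  qed
  have "u = measure lebesgue {z - u<..<z}" using u by simp
  also have "\<dots> \<le> measure lebesgue (W (b, k) \<union> (H1 \<union> (\<lambda>y. y - u) ` H2))"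
    using fm W_lmeasurable by (intro measure_mono_fmeasurable sub fmeasurable.Un) auto
  also have "\<dots> \<le> measure lebesgue (W (b, k)) + measure lebesgue (H1 \<union> (\<lambda>y. y - u) ` H2)"
    using fm W_lmeasurable by (intro measure_Un_le) (auto simp: fmeasurableD)
  also have "measure lebesgue (H1 \<union> (\<lambda>y. y - u) ` H2) \<le> measure lebesgue H1 + measure lebesgue ((\<lambda>y. y - u) ` H2)"
    using fm by (intro measure_Un_le) (auto simp: fmeasurableD)
  also have "measure lebesgue ((\<lambda>y. y - u) ` H2) = measure lebesgue H2" by (rule measure_translation_subtract)
  also have "measure lebesgue H1 + measure lebesgue H2 = measure lebesgue (H1 \<union> H2)"
    using fm by (intro measure_Union[symmetric]) (auto simp: H1_def H2_def fmeasurable_def)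
  also have "\<dots> \<le> measure lebesgue (H \<inter> nbhd (b, k))"
    using fm H_lmeasurable u
    by (intro measure_mono_fmeasurable) (auto simp: H1_def H2_def nbhd_def z_def fmeasurableD intro!: fmeasurable_Int_fmeasurable)
  finally show ?thesis by linarith
qed

lemma sum_measure_W_ge: "u * card S * (s * (q - p)) / (4 * q0) \<le> (\<Sum>x\<in>pairs. measure lebesgue (W x))"
proof -
  have "u * (card S * (s * (q - p)) / (2 * q0)) \<le> u * card pairs"
    using u by (intro mult_left_mono card_pairs) auto
  moreover have "u * card pairs - (\<Sum>x\<in>pairs. measure lebesgue (H \<inter> nbhd x)) = (\<Sum>x\<in>pairs. u - measure lebesgue (H \<inter> nbhd x))"
    by (simp add: sum_subtractf)
  moreover have "\<dots> \<le> (\<Sum>x\<in>pairs. measure lebesgue (W x))"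
    using measure_W_ge by (intro sum_mono) auto
  moreover have "u * (card S * (s * (q - p)) / (2 * q0)) = 2 * (u * card S * (s * (q - p)) / (4 * q0))" by simp
  ultimately show ?thesis using sum_H_nbhd_le by linarith
qed

lemma disjoint_W:
  assumes "(b, k) \<in> pairs" "(b', k') \<in> pairs" "k < k' + 2 * d" "k' < k + 2 * d" "(b, k) \<noteq> (b', k')"
  shows "W (b, k) \<inter> W (b', k') = {}"
proof (rule ccontr)
  assume "W (b, k) \<inter> W (b', k') \<noteq> {}"
  then obtain y where y: "y \<in> W (b, k)" "y \<in> W (b', k')" by blast
  have k: "s \<le> k" "k < 2 * s" "s \<le> k'" "k' < 2 * s" using assms K_bounds by (auto simp: pairs_def)
  then have ku: "real k * u \<le> 2 * s * u" "real k' * u \<le> 2 * s * u" using u by (auto intro!: mult_right_mono)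
  have "b = b' \<and> k = k'"
    by (rule crossing_unique[of k y b u k' b' "2 * d" "2 * s * u"])
      (use y k s u u_small ku assms in \<open>auto simp: W_def algebra_simps\<close>)
  then show False using assms by simp
qed

text \<open>The threshold is \<open>d / 4\<close> because a difference of at least
  \<open>d / 2\<close> forces one of two coefficients to reach it.\<close>

definition Y :: "(nat \<Rightarrow> int) \<Rightarrow> nat \<Rightarrow> real set" where
  "Y c j = {y \<in> A. real d / 4 \<le> \<bar>haar (walk c s y) (s + j * (2 * d)) d\<bar>}"

lemma Y_lmeasurable: "Y c j \<in> lmeasurable"
proof -
  let ?f = "\<lambda>y. \<bar>haar (walk c s y) (s + j * (2 * d)) d\<bar>"
  have "?f \<in> borel_measurable borel" by (intro borel_measurable_abs borel_measurable_haar_walk)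
  then have "{y \<in> space borel. real d / 4 \<le> ?f y} \<in> sets borel" by (rule borel_measurable_le[OF borel_measurable_const])
  then have "A \<inter> {y. real d / 4 \<le> ?f y} \<in> lmeasurable" using A by (intro fmeasurable_Int_fmeasurable) auto
  moreover have "Y c j = A \<inter> {y. real d / 4 \<le> ?f y}" by (auto simp: Y_def)
  ultimately show ?thesis by simp
qed

text \<open>The crossing changes the Haar coefficient by at least \<open>d / 2\<close>, so it is
  large at \<open>y\<close> or at \<open>y + u\<close>; the translate of \<open>Y c j\<close> covers
  the second case.\<close>

lemma W_subset_Y:
  assumes bk: "(b, k) \<in> pairs" and c: "c b \<noteq> c (b - 1)" and j: "j = (k - s) div (2 * d)"
  shows "W (b, k) \<subseteq> Y c j \<union> (\<lambda>y. y - u) ` Y c j"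
proof
  fix y assume y: "y \<in> W (b, k)"
  have k: "s \<le> k" "k < 2 * s" "p < real b / k" "central d k" using bk K_bounds by (auto simp: pairs_def)
  define v where "v = s + j * (2 * d)"
  define t where "t = (k - s) mod (2 * d)"
  have "k - s = j * (2 * d) + t" unfolding t_def j by (rule div_mult_mod_eq[symmetric])
  then have kv: "k = v + t" using k(1) by (simp add: v_def)
  have t: "t < 2 * d" using d by (simp add: t_def)
  \<comment> \<open>Since \<open>2 * d\<close> divides \<open>s\<close>, the blocks counted from
    \<open>s\<close> are those in the definition of \<open>central\<close>.\<close>
  obtain g where g: "s = 2 * d * g" using d(3) by (elim dvdE)
  have "v = 2 * d * (g + j)" by (simp add: v_def g algebra_simps)
  then have "k mod (2 * d) = t" using t by (simp add: kv)
  then have cen: "d \<le> 2 * (k - v)" "2 * (k - v) < 3 * d" using k(4) by (auto simp: central_def kv)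
  have v2: "v + 2 * d \<le> 2 * s"
  proof -
    have "k - s < 2 * d * g" using k g by simp
    then have "j < g" unfolding j using d by (simp add: div_less_iff_less_mult mult.commute)
    then have "(Suc j) * (2 * d) \<le> g * (2 * d)" by (intro mult_le_mono1) simp
    then show ?thesis by (simp add: v_def g algebra_simps)
  qed
  have iu: "real i * u \<le> 2 * s * u" if "i < v + 2 * d" for i
    using that v2 u by (intro mult_right_mono) auto
  have jump: "walk c s (y + u) i - walk c s y i
      = (walk c s (y + u) v - walk c s y v) + (if k < i then of_int (c b - c (b - 1)) else 0)"
    if "v \<le> i" "i < v + 2 * d" for i
  \<comment> \<open>All indices of the block are below \<open>2 * s\<close>, so
    \<open>2 * s * u\<close> bounds every \<open>i * u\<close>; doubling it gives the parameter
    \<open>4 * s * u\<close> of \<open>near_rational\<close>.\<close>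
  proof (rule walk_jump[where \<kappa> = "2 * s * u" and d = d])
    show "0 < y" using y k(3) p u_small s u unfolding W_def
    proof -
      have "u \<le> real s * u" using s u by simp
      then have "u < 1" using u_small u by linarith
      then show ?thesis using y k(3) p(1) unfolding W_def by auto
    qed
  qed (use y k s u u_small iu that kv t in \<open>auto simp: W_def v_def algebra_simps\<close>)
  have "\<bar>haar (walk c s (y + u)) v d - haar (walk c s y) v d\<bar> \<ge> real d / 2 * \<bar>of_int (c b - c (b - 1))\<bar>"
    by (rule haar_jump[OF jump _ cen d(2)]) (use kv in auto)
  moreover have "\<bar>real_of_int (c b - c (b - 1))\<bar> \<ge> 1" using c by linarith
  then have "real d / 2 * \<bar>of_int (c b - c (b - 1))\<bar> \<ge> real d / 2 * 1" by (intro mult_left_mono) auto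
  ultimately have "real d / 4 \<le> \<bar>haar (walk c s (y + u)) v d\<bar> \<or> real d / 4 \<le> \<bar>haar (walk c s y) v d\<bar>"
    by linarith
  then show "y \<in> Y c j \<union> (\<lambda>y. y - u) ` Y c j"
  proof
    assume "real d / 4 \<le> \<bar>haar (walk c s (y + u)) v d\<bar>"
    then have "y + u \<in> Y c j" using y by (auto simp: Y_def W_def v_def)
    then have "(y + u) - u \<in> (\<lambda>y. y - u) ` Y c j" by (rule imageI)
    then show ?thesis by simp
  qed (use y in \<open>auto simp: Y_def W_def v_def\<close>)
qed

text \<open>The pairs are grouped by the block \<open>J x\<close> containing \<open>k\<close>.
  Within one block the sets \<open>W x\<close> are disjoint and lie in \<open>Y c j\<close> or its
  translate, so their measures add up to at most twice that of \<open>Y c j\<close>.\<close>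

lemma sum_measure_Y_ge:
  assumes c: "\<And>b. b \<in> S \<Longrightarrow> c b \<noteq> c (b - 1)"
  shows "u * card S * (s * (q - p)) / (8 * q0) \<le> (\<Sum>j<s div (2 * d). measure lebesgue (Y c j))"
proof -
  define J where "J x = (snd x - s) div (2 * d)" for x :: "nat \<times> nat"
  define P where "P j = {x \<in> pairs. J x = j}" for j
  have J_range: "J ` pairs \<subseteq> {..<s div (2 * d)}"
  proof
    fix j assume "j \<in> J ` pairs"
    then obtain b k where bk: "(b, k) \<in> pairs" "j = (k - s) div (2 * d)" by (auto simp: J_def)
    have "k < 2 * s" "s \<le> k" using bk K_bounds by (auto simp: pairs_def)
    then have "k - s < s" by simp
    moreover obtain g where "s = 2 * d * g" using d(3) by (elim dvdE)
    ultimately show "j \<in> {..<s div (2 * d)}" using d bk by (simp add: div_less_iff_less_mult mult.commute)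
  qed
  have block: "(\<Sum>x\<in>P j. measure lebesgue (W x)) \<le> 2 * measure lebesgue (Y c j)" for j
  proof -
    have disj: "pairwise (\<lambda>x y. disjnt (W x) (W y)) (P j)"
    proof (rule pairwiseI)
      fix x y assume xy: "x \<in> P j" "y \<in> P j" "x \<noteq> y"
      obtain b k b' k' where e: "x = (b, k)" "y = (b', k')" by force
      have pr: "(b, k) \<in> pairs" "(b', k') \<in> pairs" using xy by (auto simp: P_def e)
      then have "s \<le> k" "s \<le> k'" using K_bounds by (auto simp: pairs_def)
      have "(k - s) div (2 * d) = (k' - s) div (2 * d)" using xy by (auto simp: P_def J_def e)
      then have "k - s < k' - s + 2 * d" "k' - s < k - s + 2 * d"
        using d by (auto intro!: less_add_of_div_eq)
      then have "k < k' + 2 * d" "k' < k + 2 * d" using \<open>s \<le> k\<close> \<open>s \<le> k'\<close> by linarith+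
      then show "disjnt (W x) (W y)" using disjoint_W[OF pr] xy e by (simp add: disjnt_def)
    qed
    have "(\<Sum>x\<in>P j. measure lebesgue (W x)) = measure lebesgue (\<Union>x\<in>P j. W x)"
      using finite_pairs W_lmeasurable disj by (intro measure_UNION'[symmetric]) (auto simp: P_def)
    also have "\<dots> \<le> measure lebesgue (Y c j \<union> (\<lambda>y. y - u) ` Y c j)"
    proof (rule measure_mono_fmeasurable)
      show "(\<Union>x\<in>P j. W x) \<subseteq> Y c j \<union> (\<lambda>y. y - u) ` Y c j"
      proof (rule UN_least)
        fix x assume x: "x \<in> P j"
        obtain b k where e: "x = (b, k)" by force
        have "b \<in> S" using x by (auto simp: P_def pairs_def e)
        then show "W x \<subseteq> Y c j \<union> (\<lambda>y. y - u) ` Y c j"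
          unfolding e using x c by (intro W_subset_Y) (auto simp: P_def J_def e)
      qed
      show "(\<Union>x\<in>P j. W x) \<in> sets lebesgue"
        using finite_pairs W_lmeasurable by (intro sets.finite_UN) (auto simp: P_def fmeasurableD)
    qed (intro fmeasurable.Un Y_lmeasurable measurable_translation_subtract)
    also have "\<dots> \<le> measure lebesgue (Y c j) + measure lebesgue ((\<lambda>y. y - u) ` Y c j)"
      using Y_lmeasurable measurable_translation_subtract[OF Y_lmeasurable]
      by (intro measure_Un_le) (auto simp: fmeasurableD)
    also have "\<dots> = 2 * measure lebesgue (Y c j)" by (simp add: measure_translation_subtract)
    finally show ?thesis .
  qed
  have "(\<Sum>x\<in>pairs. measure lebesgue (W x)) = (\<Sum>j<s div (2 * d). \<Sum>x\<in>P j. measure lebesgue (W x))"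
    unfolding P_def by (rule sum.group[OF finite_pairs _ J_range, symmetric]) simp
  also have "\<dots> \<le> (\<Sum>j<s div (2 * d). 2 * measure lebesgue (Y c j))" by (intro sum_mono block)
  also have "\<dots> = 2 * (\<Sum>j<s div (2 * d). measure lebesgue (Y c j))" by (simp add: sum_distrib_left)
  finally show ?thesis using sum_measure_W_ge by simp
qed

end

section \<open>Summing the energy over dyadic lengths\<close>

text \<open>On its \<open>Y\<close>, a block of length \<open>2 ^ Suc r\<close> carries energy at
  least \<open>(2 ^ r / 4)\<^sup>2 / 2 ^ Suc r = 2 ^ r / 32\<close>, and Bessel bounds the total at
  each \<open>y\<close>. The radius is inversely proportional to \<open>2 ^ w * 2 ^ Suc r\<close>,
  which makes the lower bound the same for each of the \<open>h\<close> values of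
  \<open>r\<close>.\<close>

lemma energy_bound:
  fixes D a :: real and h w :: nat
  assumes scale: "\<And>r. h \<le> r \<Longrightarrow> r < 2 * h \<Longrightarrow> crossing_scale A S p q q0 (a / (2 ^ w * 2 ^ Suc r)) (2 ^ w) (2 ^ r) N Q"
    and "2 * h \<le> w" and A: "A \<in> lmeasurable" and "0 < q0"
    and jumps: "\<And>b. b \<in> S \<Longrightarrow> c b \<noteq> c (b - 1)"
    and D: "\<And>y k. y \<in> A \<Longrightarrow> k < 2 * 2 ^ w \<Longrightarrow> \<bar>walk c (2 ^ w) y k\<bar> \<le> D"
  shows "real h * (a * card S * (q - p) / (512 * q0)) \<le> 2 ^ w * D\<^sup>2 * measure lebesgue A"
proof -
  let ?s = "2 ^ w :: nat"
  let ?Y = "\<lambda>r. crossing_scale.Y A ?s (2 ^ r) c"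
  define I where "I = Sigma {h..<2 * h} (\<lambda>r. {..<(2::nat) ^ (w - Suc r)})"
  have Y: "?Y r j = {y \<in> A. real (2 ^ r) / 4 \<le> \<bar>haar (walk c ?s y) (?s + j * 2 ^ Suc r) (2 ^ r)\<bar>}"
    if "h \<le> r" "r < 2 * h" for r j
    using crossing_scale.Y_def[OF scale[OF that], of c j] by simp
  have Ym: "?Y r j \<in> lmeasurable" if "h \<le> r" "r < 2 * h" for r j
    using crossing_scale.Y_lmeasurable[OF scale[OF that]] .
  have "(\<Sum>(r, j)\<in>I. 2 ^ r / 32 * measure lebesgue (?Y r j)) \<le> ?s * D\<^sup>2 * measure lebesgue A"
  proof -
    have "(\<Sum>rj\<in>I. 2 ^ fst rj / 32 * measure lebesgue (?Y (fst rj) (snd rj))) \<le> ?s * D\<^sup>2 * measure lebesgue A"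
    proof (rule weighted_measure_sum_le)
      show "finite I" by (simp add: I_def)
      fix y assume y: "y \<in> A"
      let ?P = "walk c ?s y"
      have "(\<Sum>rj\<in>I. 2 ^ fst rj / 32 * indicator (?Y (fst rj) (snd rj)) y)
        \<le> (\<Sum>rj\<in>I. 1 / 2 ^ Suc (fst rj) * (haar ?P (?s + snd rj * 2 ^ Suc (fst rj)) (2 ^ fst rj))\<^sup>2)"
      proof (rule sum_mono)
        fix rj assume "rj \<in> I"
        then obtain r j where rj: "rj = (r, j)" "h \<le> r" "r < 2 * h" by (auto simp: I_def)
        let ?h = "haar ?P (?s + j * 2 ^ Suc r) (2 ^ r)"
        have "2 ^ r / 32 * indicator (?Y r j) y \<le> 1 / 2 ^ Suc r * ?h\<^sup>2"
        proof (cases "y \<in> ?Y r j")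
          case True
          then have "2 ^ r / 4 \<le> \<bar>?h\<bar>" using Y rj by simp
          then have "(2 ^ r / 4)\<^sup>2 \<le> \<bar>?h\<bar>\<^sup>2" by (intro power_mono) auto
          then have "1 / 2 ^ Suc r * (2 ^ r / 4)\<^sup>2 \<le> 1 / 2 ^ Suc r * ?h\<^sup>2" by (intro mult_left_mono) auto
          moreover have "1 / 2 ^ Suc r * (2 ^ r / 4)\<^sup>2 = (2 ^ r / 32 :: real)" by (simp add: power2_eq_square)
          ultimately show ?thesis using True by simp
        qed simp
        then show "2 ^ fst rj / 32 * indicator (?Y (fst rj) (snd rj)) y
          \<le> 1 / 2 ^ Suc (fst rj) * (haar ?P (?s + snd rj * 2 ^ Suc (fst rj)) (2 ^ fst rj))\<^sup>2"
          by (simp add: rj)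
      qed
      also have "\<dots> = (\<Sum>r\<in>{h..<2 * h}. 1 / 2 ^ Suc r * (\<Sum>j<2 ^ (w - Suc r). (haar ?P (?s + j * 2 ^ Suc r) (2 ^ r))\<^sup>2))"
        unfolding I_def sum_distrib_left by (subst sum.Sigma) (auto simp: case_prod_unfold)
      also have "\<dots> \<le> (\<Sum>r<2 * h. 1 / 2 ^ Suc r * (\<Sum>j<2 ^ (w - Suc r). (haar ?P (?s + j * 2 ^ Suc r) (2 ^ r))\<^sup>2))"
        by (intro sum_mono2) (auto intro!: divide_nonneg_nonneg sum_nonneg)
      also have "\<dots> \<le> (\<Sum>k<2 ^ w. (?P (?s + k))\<^sup>2)" by (rule haar_bessel) fact
      also have "\<dots> \<le> (\<Sum>k<(2::nat) ^ w. D\<^sup>2)"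
      proof (rule sum_mono)
        fix k assume "k \<in> {..<(2::nat) ^ w}"
        then have "\<bar>?P (?s + k)\<bar> \<le> D" using D[OF y] by simp
        then show "(?P (?s + k))\<^sup>2 \<le> D\<^sup>2" by (rule abs_le_square_iff[THEN iffD1, OF order_trans]) simp
      qed
      finally show "(\<Sum>rj\<in>I. 2 ^ fst rj / 32 * indicator (?Y (fst rj) (snd rj)) y) \<le> ?s * D\<^sup>2" by simp
    qed (use A Ym Y in \<open>auto simp: I_def fmeasurableD\<close>)
    then show ?thesis by (simp add: case_prod_unfold)
  qed
  moreover have "(\<Sum>(r, j)\<in>I. 2 ^ r / 32 * measure lebesgue (?Y r j))
      = (\<Sum>r\<in>{h..<2 * h}. 2 ^ r / 32 * (\<Sum>j<2 ^ (w - Suc r). measure lebesgue (?Y r j)))"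
    unfolding I_def sum_distrib_left by (subst sum.Sigma) auto
  moreover have "\<dots> \<ge> (\<Sum>r\<in>{h..<2 * h}. a * card S * (q - p) / (512 * q0))"
  proof (rule sum_mono)
    fix r assume "r \<in> {h..<2 * h}"
    then have r: "h \<le> r" "r < 2 * h" "Suc r \<le> w" using \<open>2 * h \<le> w\<close> by auto
    have div: "?s div (2 * 2 ^ r) = 2 ^ (w - Suc r)"
      using r(3) by (simp add: power_diff flip: power_Suc)
    have "a / (2 ^ w * 2 ^ Suc r) * card S * (?s * (q - p)) / (8 * q0) \<le> (\<Sum>j<?s div (2 * 2 ^ r). measure lebesgue (?Y r j))"
      by (rule crossing_scale.sum_measure_Y_ge[OF scale[OF r(1,2)]]) (rule jumps)
    then have "2 ^ r / 32 * (a / (2 ^ w * 2 ^ Suc r) * card S * (?s * (q - p)) / (8 * q0))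
        \<le> 2 ^ r / 32 * (\<Sum>j<2 ^ (w - Suc r). measure lebesgue (?Y r j))"
      unfolding div by (intro mult_left_mono) auto
    moreover have "2 ^ r / 32 * (a / (2 ^ w * 2 ^ Suc r) * card S * (?s * (q - p)) / (8 * q0)) = a * card S * (q - p) / (512 * q0)"
      using \<open>0 < q0\<close> by (simp add: field_simps)
    ultimately show "a * card S * (q - p) / (512 * q0) \<le> 2 ^ r / 32 * (\<Sum>j<2 ^ (w - Suc r). measure lebesgue (?Y r j))"
      by simp
  qed
  ultimately show ?thesis by simp
qed

section \<open>Bounded discrepancy and positive density force many jumps\<close>

lemma constant_of_no_jumps:
  fixes c :: "nat \<Rightarrow> 'a"
  assumes "\<And>b. x < b \<Longrightarrow> b \<le> x + m \<Longrightarrow> c b = c (b - 1)"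
  shows "c (x + m) = c x"
  using assms by (induction m) auto

text \<open>A nonzero constant run of length \<open>W\<close> contains more than
  \<open>D + 1\<close> consecutive terms of the quasi-progression, all of one sign.\<close>

lemma no_long_constant_runs:
  fixes c :: "nat \<Rightarrow> int" and y q0 D :: real and W x n :: nat
  assumes y: "1 \<le> y" "y \<le> q0" and W: "q0 * (D + 2) \<le> W" and n: "x + W \<le> n" and "0 \<le> D"
    and D: "\<And>i t. i \<le> t \<Longrightarrow> \<lfloor>real t * y\<rfloor> \<le> int n \<Longrightarrow> \<bar>quasi_sum c y i t\<bar> \<le> D"
    and "c x \<noteq> 0"
  shows "\<exists>b. x < b \<and> b < x + W \<and> c b \<noteq> c (b - 1)"
proof (rule ccontr)
  assume "\<not> ?thesis"
  then have no: "c b = c (b - 1)" if "x < b" "b < x + W" for b using that by blast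
  have const: "c b = c x" if "x \<le> b" "b < x + W" for b
  proof -
    have "c (x + (b - x)) = c x" using that by (intro constant_of_no_jumps no) auto
    then show ?thesis using that by simp
  qed
  \<comment> \<open>The indices \<open>k1, ..., m - 1\<close> are exactly the \<open>k\<close> with
    \<open>x \<le> k * y < x + W\<close>.\<close>
  define k1 where "k1 = nat \<lceil>x / y\<rceil>"
  define m where "m = nat \<lceil>(x + W) / y\<rceil>"
  have "(D + 2) * y \<le> (D + 2) * q0" using y \<open>0 \<le> D\<close> by (intro mult_left_mono) auto
  then have "(D + 2) * y \<le> W" using W by (simp add: mult.commute)
  then have "D + 2 \<le> W / y" using y by (simp add: field_simps)
  then have gap: "x / y + (D + 2) \<le> (x + W) / y" by (simp add: add_divide_distrib)
  have x0: "0 \<le> x / y" using y by simp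
  have km: "D + 1 < real m - real k1" "k1 < m"
    unfolding m_def k1_def using gap x0 \<open>0 \<le> D\<close> by linarith+
  have val: "c (nat \<lfloor>real k * y\<rfloor>) = c x" if "k \<in> {k1..m - 1}" for k
  proof -
    have "x / y \<le> k" using that by (simp add: k1_def)
    then have lo: "x \<le> real k * y" using y by (simp add: field_simps)
    have "k < m" using that km by auto
    then have "k < (x + W) / y" unfolding m_def by linarith
    then have "real k * y < x + W" using y by (simp add: field_simps)
    then show ?thesis using lo by (intro const) linarith+
  qed
  have "quasi_sum c y k1 (m - 1) = (\<Sum>k\<in>{k1..m - 1}. c x)"
    unfolding quasi_sum_def by (intro sum.cong refl val)
  also have "\<dots> = (int m - int k1) * c x" using km by (simp add: of_nat_diff)
  finally have qs: "quasi_sum c y k1 (m - 1) = (int m - int k1) * c x" .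
  have "real (m - 1) < (x + W) / y" using km unfolding m_def by linarith
  then have "real (m - 1) * y < x + W" using y by (simp add: field_simps)
  then have "\<lfloor>real (m - 1) * y\<rfloor> \<le> int n" using n by linarith
  then have "\<bar>quasi_sum c y k1 (m - 1)\<bar> \<le> D" using km by (intro D) auto
  moreover have "1 * \<bar>int m - int k1\<bar> \<le> \<bar>c x\<bar> * \<bar>int m - int k1\<bar>"
    using \<open>c x \<noteq> 0\<close> by (intro mult_right_mono) auto
  then have "real m - real k1 \<le> \<bar>quasi_sum c y k1 (m - 1)\<bar>"
    unfolding qs abs_mult using km by (simp add: mult.commute)
  ultimately show False using km \<open>0 \<le> D\<close> by linarith
qed

text \<open>Each coloured position is followed by a jump \<open>b\<close> at distance less than
  \<open>W\<close>. It lies in \<open>{b - W..<b}\<close> if \<open>b < Y\<close>, and otherwise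
  among the last \<open>W\<close> positions before \<open>Y\<close>.\<close>

lemma card_nonzero_le:
  fixes c :: "nat \<Rightarrow> int"
  assumes runs: "\<And>x. x + W \<le> n \<Longrightarrow> c x \<noteq> 0 \<Longrightarrow> \<exists>b. x < b \<and> b < x + W \<and> c b \<noteq> c (b - 1)"
    and "Y + W \<le> n"
  shows "card {b. X \<le> b \<and> b < Y \<and> c b \<noteq> 0} \<le> W * card {b. X \<le> b \<and> b < Y \<and> c b \<noteq> c (b - 1)} + W"
proof -
  let ?S = "{b. X \<le> b \<and> b < Y \<and> c b \<noteq> c (b - 1)}"
  have "{b. X \<le> b \<and> b < Y \<and> c b \<noteq> 0} \<subseteq> (\<Union>b\<in>?S. {b - W..<b}) \<union> {Y - W..<Y}"
  proof
    fix x assume x: "x \<in> {b. X \<le> b \<and> b < Y \<and> c b \<noteq> 0}"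
    then obtain b where b: "x < b" "b < x + W" "c b \<noteq> c (b - 1)"
      using runs[of x] \<open>Y + W \<le> n\<close> by auto
    show "x \<in> (\<Union>b\<in>?S. {b - W..<b}) \<union> {Y - W..<Y}"
    proof (cases "b < Y")
      case True
      then have "b \<in> {b. X \<le> b \<and> b < Y \<and> c b \<noteq> c (b - 1)}" using x b by simp
      moreover have "x \<in> {b - W..<b}" using b by auto
      ultimately show ?thesis by blast
    qed (use x b in auto)
  qed
  then have "card {b. X \<le> b \<and> b < Y \<and> c b \<noteq> 0} \<le> card ((\<Union>b\<in>?S. {b - W..<b}) \<union> {Y - W..<Y})"
    by (intro card_mono) auto
  also have "\<dots> \<le> card (\<Union>b\<in>?S. {b - W..<b}) + card {Y - W..<Y}" by (rule card_Un_le)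
  also have "card (\<Union>b\<in>?S. {b - W..<b}) \<le> (\<Sum>b\<in>?S. card {b - W..<b})" by (rule card_UN_le) auto
  also have "\<dots> \<le> (\<Sum>b\<in>?S. W)" by (intro sum_mono) auto
  also have "card {Y - W..<Y} \<le> W" by auto
  finally show ?thesis by (simp add: mult.commute)
qed

text \<open>Subtract the density estimates at the two ends of the window. Its length is about
  \<open>p * s / 2\<close>; the tolerance \<open>\<rho> / 100\<close> loses only about
  \<open>0.035 * \<rho> * p * s\<close>, so \<open>\<rho> * s / 4\<close> survives.\<close>

lemma eventually_card_nonzero_ge:
  fixes c :: "nat \<Rightarrow> int" and p \<rho> :: real
  assumes dens: "colouring_density c \<rho>" and "0 < \<rho>" "1 \<le> p"
  shows "\<forall>\<^sub>F s in sequentially.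
    \<rho> * s / 4 \<le> card {b. nat \<lceil>3 / 2 * p * real s\<rceil> \<le> b \<and> b < nat \<lceil>2 * p * real s\<rceil> \<and> c b \<noteq> 0}"
proof -
  define C where "C n = card ({b. c b \<noteq> 0} \<inter> {..<n})" for n
  have "(\<lambda>n. real (C n) / n) \<longlonglongrightarrow> \<rho>"
    using dens unfolding colouring_density_def has_asymptotic_density_def C_def .
  then have "\<forall>\<^sub>F n in sequentially. dist (real (C n) / n) \<rho> < \<rho> / 100"
    using \<open>0 < \<rho>\<close> by (intro tendstoD) auto
  then obtain n1 where n1: "\<And>n. n \<ge> n1 \<Longrightarrow> \<bar>real (C n) / n - \<rho>\<bar> < \<rho> / 100"
    unfolding eventually_sequentially dist_real_def by blast
  have est: "\<bar>real (C n) - \<rho> * n\<bar> \<le> \<rho> / 100 * n" if "n \<ge> n1" for n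
  proof (cases "n = 0")
    case False
    have "real (C n) - \<rho> * n = (real (C n) / n - \<rho>) * n"
      using False by (simp add: left_diff_distrib)
    then have "\<bar>real (C n) - \<rho> * n\<bar> = \<bar>real (C n) / n - \<rho>\<bar> * n" by (simp add: abs_mult)
    also have "\<dots> \<le> \<rho> / 100 * n" using n1[OF that] by (intro mult_right_mono) auto
    finally show ?thesis .
  qed (simp add: C_def)
  show ?thesis unfolding eventually_sequentially
  proof (intro exI allI impI)
    fix s assume s: "s \<ge> n1 + 10"
    define X where "X = nat \<lceil>3 / 2 * p * real s\<rceil>"
    define Y where "Y = nat \<lceil>2 * p * real s\<rceil>"
    have ps: "real s \<le> p * s" "10 \<le> real s" using \<open>1 \<le> p\<close> s by (auto simp: mult_le_cancel_right1)
    have X: "3 / 2 * (p * s) \<le> X" "X \<le> 3 / 2 * (p * s) + 1"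
      and Y: "2 * (p * s) \<le> Y" "Y \<le> 2 * (p * s) + 1"
      unfolding X_def Y_def using ps by linarith+
    have n1s: "n1 \<le> X" "n1 \<le> Y" using X Y ps s by linarith+
    have "C Y \<le> C X + card {b. X \<le> b \<and> b < Y \<and> c b \<noteq> 0}"
    proof -
      have "{b. c b \<noteq> 0} \<inter> {..<Y} \<subseteq> ({b. c b \<noteq> 0} \<inter> {..<X}) \<union> {b. X \<le> b \<and> b < Y \<and> c b \<noteq> 0}" by auto
      then have "C Y \<le> card (({b. c b \<noteq> 0} \<inter> {..<X}) \<union> {b. X \<le> b \<and> b < Y \<and> c b \<noteq> 0})"
        unfolding C_def by (intro card_mono) auto
      also have "\<dots> \<le> C X + card {b. X \<le> b \<and> b < Y \<and> c b \<noteq> 0}" unfolding C_def by (rule card_Un_le)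
      finally show ?thesis .
    qed
    then have "real (C Y) - real (C X) \<le> card {b. X \<le> b \<and> b < Y \<and> c b \<noteq> 0}" by linarith
    moreover have "real (C Y) - real (C X) \<ge> \<rho> * (real Y - real X) - \<rho> / 100 * (real X + real Y)"
      using est[OF n1s(1)] est[OF n1s(2)] unfolding distrib_left right_diff_distrib by linarith
    moreover have "\<rho> * (real Y - X) - \<rho> / 100 * (real X + Y) = \<rho> * (real Y - X - (real X + Y) / 100)"
      by (simp add: algebra_simps)
    moreover have "real s / 4 \<le> real Y - X - (real X + Y) / 100"
    proof -
      have "100 * (real Y - X) - (real X + Y) \<ge> 25 * real s" using X Y ps by argo
      then show ?thesis by (simp add: field_simps)
    qed
    then have "\<rho> * (s / 4) \<le> \<rho> * (real Y - X - (real X + Y) / 100)" using \<open>0 < \<rho>\<close> by (intro mult_left_mono) auto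
    ultimately show "\<rho> * s / 4 \<le> card {b. nat \<lceil>3 / 2 * p * real s\<rceil> \<le> b \<and> b < nat \<lceil>2 * p * real s\<rceil> \<and> c b \<noteq> 0}"
      unfolding X_def[symmetric] Y_def[symmetric] by simp
  qed
qed

section \<open>Asymptotic inequalities for \<open>s = 2 ^ (20 * h)\<close>,
  \<open>N = 2 ^ (10 * h)\<close> and \<open>d < 2 ^ (2 * h)\<close>\<close>

lemma eventually_block_small:
  fixes q0 l :: real
  assumes "q0 \<ge> 1" "l > 0"
  shows "\<forall>\<^sub>F h::nat in sequentially. 2 * q0 * (1 + 2 ^ (2 * h)) \<le> 2 ^ (20 * h) * l"
  using assms by real_asymp

lemma eventually_Dirichlet_bound_small:
  fixes l :: real
  assumes "l > 0"
  shows "\<forall>\<^sub>F h::nat in sequentially. 2 ^ (10 * h) \<le> 2 ^ (20 * h) * l"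
  using assms by real_asymp

text \<open>Supplies \<open>S_large\<close>: the left side has order \<open>2 ^ (14 * h)\<close>,
  the right side order \<open>2 ^ (18 * h) / h powr (1 / 4)\<close>.\<close>

lemma eventually_exceptions_few:
  fixes q0 a \<rho> :: real
  assumes "q0 \<ge> 1" "a > 0" "\<rho> > 0"
  shows "\<forall>\<^sub>F h::nat in sequentially.
     3 * ((2 ^ (2 * h) / (8 * a) + 1) * (2 * (2 ^ (2 * h) / (8 * a) + 1) + 1) * (4 * q0 * 2 ^ (20 * h) / 2 ^ (10 * h) + 1))
     \<le> 160 * (a / 2 ^ (2 * h)) * (\<rho> * 2 ^ (20 * h) / (4 * (q0 * ((20 * real h) powr (1 / 4) + 2) + 1)) - 1)"
  using assms by real_asymp

text \<open>Contradicts \<open>energy_bound\<close>: after division by \<open>2 ^ (20 * h)\<close>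
  the upper bound has order \<open>h powr (1 / 2)\<close>, the lower bound order
  \<open>h powr (3 / 4)\<close>.\<close>

lemma eventually_energy_large:
  fixes q0 k1 k2 \<rho> :: real
  assumes "q0 \<ge> 1" "k1 > 0" "k2 \<ge> 0" "\<rho> > 0"
  shows "\<forall>\<^sub>F h::nat in sequentially.
     2 ^ (20 * h) * ((20 * real h) powr (1 / 4))\<^sup>2 * k2
     < real h * (k1 * (\<rho> * 2 ^ (20 * h) / (4 * (q0 * ((20 * real h) powr (1 / 4) + 2) + 1)) - 1))"
  using assms by real_asymp

text \<open>The logarithm is \<open>20 * h * ln 2\<close> up to a bounded term, and
  \<open>ln 2 < 1\<close> leaves room for that term.\<close>

lemma eventually_ln_range_le:
  fixes q0 :: real
  assumes "q0 \<ge> 1"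
  shows "\<forall>\<^sub>F h::nat in sequentially. ln (4 * q0 * 2 ^ (20 * h) + 1) \<le> 20 * real h"
proof -
  have ln2: "ln 2 < (1 :: real)" using ln_less_self[of 2] ln2_le_25_over_36 by linarith
  define \<delta> :: real where "\<delta> = 1 - ln 2"
  have "\<delta> > 0" using ln2 by (simp add: \<delta>_def)
  then have "\<forall>\<^sub>F h::nat in sequentially. ln (5 * q0) \<le> 20 * real h * \<delta>"
    by real_asymp
  then show ?thesis
  proof eventually_elim
    case (elim h)
    have "1 * 1 \<le> q0 * 2 ^ (20 * h)" using assms by (intro mult_mono) auto
    then have "ln (4 * q0 * 2 ^ (20 * h) + 1) \<le> ln (5 * q0 * 2 ^ (20 * h))"
      using assms by (subst ln_le_cancel_iff) (auto intro: add_pos_pos)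
    also have "\<dots> = ln (5 * q0) + 20 * real h * ln 2"
      using assms by (simp add: ln_mult ln_realpow)
    also have "\<dots> \<le> 20 * real h" using elim by (simp add: \<delta>_def algebra_simps)
    finally show ?case .
  qed
qed

lemma eventually_window_small:
  fixes q0 :: real
  assumes "q0 \<ge> 1"
  shows "\<forall>\<^sub>F h::nat in sequentially. q0 * ((20 * real h) powr (1 / 4) + 2) + 3 \<le> q0 * 2 ^ (20 * h)"
  using assms by real_asymp


section \<open>Bounded discrepancy on a set of positive measure is impossible\<close>

text \<open>Three pieces: the two margins cost \<open>2 * u \<le> 2 * a\<close>, the complement of
  \<open>A\<close> in \<open>(p, q)\<close> costs \<open>\<eta> * (q - p)\<close>, and the
  near-rational points cost at most \<open>28 * a\<close>.\<close>

lemma measure_bad_le: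
  fixes p q u a \<kappa> \<eta> :: real
  assumes A: "A \<in> lmeasurable" and pq: "p < q" "q - p \<le> 1"
    and dense: "(1 - \<eta>) * (q - p) \<le> measure lebesgue (A \<inter> {p<..<q})"
    and a: "a \<le> 1 / 16" and u: "0 < u" "u \<le> a" and m: "real m * \<kappa> = 4 * a" "0 < \<kappa>" "\<kappa> \<le> 1 / 2"
  shows "measure lebesgue ({p - u<..<q + u} - (A - near_rational m \<kappa>)) \<le> \<eta> * (q - p) + 40 * a"
proof -
  let ?N = "near_rational m \<kappa> \<inter> {p - u<..<q + u}"
  have [measurable]: "near_rational m \<kappa> \<in> sets lebesgue" using open_near_rational by simp
  have N: "?N \<in> lmeasurable" by (subst Int_commute) (simp add: fmeasurable_Int_fmeasurable)
  have D: "{p<..<q} - A \<in> lmeasurable" using A by (intro fmeasurable.Diff) auto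
  have sub: "{p - u<..<q + u} - (A - near_rational m \<kappa>) \<subseteq> ({p - u..p} \<union> {q..q + u}) \<union> (({p<..<q} - A) \<union> ?N)"
    by auto
  have "measure lebesgue ({p - u<..<q + u} - (A - near_rational m \<kappa>))
      \<le> measure lebesgue (({p - u..p} \<union> {q..q + u}) \<union> (({p<..<q} - A) \<union> ?N))"
    using A N D by (intro measure_mono_fmeasurable sub fmeasurable.Un) (auto simp: fmeasurableD)
  also have "\<dots> \<le> measure lebesgue ({p - u..p} \<union> {q..q + u}) + measure lebesgue (({p<..<q} - A) \<union> ?N)"
    using N D by (intro measure_Un_le) (auto simp: fmeasurableD)
  also have "measure lebesgue ({p - u..p} \<union> {q..q + u}) \<le> measure lebesgue {p - u..p} + measure lebesgue {q..q + u}"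
    by (intro measure_Un_le) auto
  also have "measure lebesgue {p - u..p} + measure lebesgue {q..q + u} = 2 * u" using u by simp
  also have "measure lebesgue (({p<..<q} - A) \<union> ?N) \<le> measure lebesgue ({p<..<q} - A) + measure lebesgue ?N"
    using N D by (intro measure_Un_le) (auto simp: fmeasurableD)
  also have "measure lebesgue ({p<..<q} - A) \<le> \<eta> * (q - p)"
  proof -
    have AJ: "A \<inter> {p<..<q} \<in> sets lebesgue" using A by (auto simp: fmeasurableD)
    have "{p<..<q} - A = {p<..<q} - (A \<inter> {p<..<q})" by auto
    also have "measure lebesgue \<dots> = measure lebesgue {p<..<q} - measure lebesgue (A \<inter> {p<..<q})"
      using AJ by (intro measurable_measure_Diff) auto
    also have "measure lebesgue {p<..<q} = q - p" using pq by simp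
    finally show ?thesis using dense by (simp add: algebra_simps)
  qed
  also have "measure lebesgue ?N \<le> 4 * a * (2 * ((q + u) - (p - u)) + 4)"
    using measure_near_rational_le[of "p - u" "q + u" \<kappa> m] pq u m by simp
  also have "4 * a * (2 * ((q + u) - (p - u)) + 4) \<le> 4 * a * 7"
    using u a pq by (intro mult_left_mono) auto
  finally show ?thesis using u by linarith
qed

text \<open>On a set of positive measure the two bounds for the Haar energy are incompatible for
  large \<open>h\<close>. The interval has length \<open>1 / 2\<close> so that
  \<open>p \<ge> 1\<close> yields \<open>2 * q \<le> 3 * p\<close>.\<close>

lemma negligible_bounded_discrepancy:
  fixes c :: "nat \<Rightarrow> int" and g \<rho> :: real
  assumes dens: "colouring_density c \<rho>" and "0 < \<rho>" and "1 \<le> g"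
    and A: "A \<in> lmeasurable" "A \<subseteq> {g..g + 1 / 2}"
    and bounded: "\<And>y n i t. y \<in> A \<Longrightarrow> n0 \<le> n \<Longrightarrow> i \<le> t \<Longrightarrow> \<lfloor>real t * y\<rfloor> \<le> int n
        \<Longrightarrow> \<bar>quasi_sum c y i t\<bar> \<le> ln (real n) powr (1 / 4)"
  shows "measure lebesgue A = 0"
proof (rule ccontr)
  assume "measure lebesgue A \<noteq> 0"
  then have A0: "measure lebesgue A > 0" by (simp add: zero_less_measure_iff)
  define q0 where "q0 = g + 1"
  define \<eta> where "\<eta> = 1 / (40960 * q0\<^sup>2)"
  have q0: "1 \<le> q0" using \<open>1 \<le> g\<close> by (simp add: q0_def)
  then have \<eta>: "0 < \<eta>" by (simp add: \<eta>_def)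
  obtain p q where pq: "g \<le> p" "p < q" "q \<le> g + 1 / 2"
    and dense: "(1 - \<eta>) * (q - p) \<le> measure lebesgue (A \<inter> {p<..<q})"
    using exists_interval_of_high_density[OF A A0 \<eta>] by blast
  \<comment> \<open>With this \<open>a\<close> and \<open>\<eta>\<close>, the bad measure
    \<open>\<eta> * (q - p) + 40 * a\<close> is \<open>0.65\<close> times the bound allowed by
    \<open>A_dense\<close>.\<close>
  define a where "a = (q - p) / (1024000 * q0\<^sup>2)"
  have q02: "1 \<le> q0\<^sup>2" using q0 by simp
  have a0: "0 < a" using pq q0 by (simp add: a_def)
  have a1: "a \<le> 1 / 16"
  proof -
    have "a \<le> 1 / (1024000 * 1)" unfolding a_def using pq q02 by (intro frac_le) auto
    then show ?thesis by simp
  qed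
  have C1: "\<eta> * (q - p) + 40 * a \<le> (q - p) / (10240 * q0\<^sup>2)"
    using pq q0 by (simp add: a_def \<eta>_def field_simps)
  define E where "E h = (20 * real h) powr (1 / 4)" for h :: nat
  \<comment> \<open>\<open>E h\<close> will bound the discrepancy, \<open>M h\<close> bound the
    number of jumps from below and \<open>Z h\<close> bound \<open>Q\<close> from above;
    \<open>n h\<close> is large enough to contain \<open>\<lfloor>k * y\<rfloor>\<close> for all
    \<open>k < 2 * s\<close>.\<close>
  define M where "M h = \<rho> * 2 ^ (20 * h) / (4 * (q0 * (E h + 2) + 1)) - 1" for h :: nat
  define Z where "Z h = (2 :: real) ^ (2 * h) / (8 * a) + 1" for h :: nat
  define n where "n h = nat \<lceil>4 * q0 * 2 ^ (20 * h)\<rceil>" for h :: nat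
  have k1: "0 < a * (q - p) / (512 * q0)" using a0 pq q0 by simp
  have pow: "filterlim (\<lambda>h::nat. (2::nat) ^ (20 * h)) sequentially sequentially"
  proof (rule filterlim_subseq, rule strict_monoI)
    fix x y :: nat assume "x < y"
    then show "(2::nat) ^ (20 * x) < 2 ^ (20 * y)" by (intro power_strict_increasing) auto
  qed
  have "1 \<le> p" using pq \<open>1 \<le> g\<close> by simp
  have l0: "0 < q - p" using pq by simp
  have ev: "\<forall>\<^sub>F h in sequentially. \<rho> * real ((2::nat) ^ (20 * h)) / 4 \<le> card {b. nat \<lceil>3 / 2 * p * real ((2::nat) ^ (20 * h))\<rceil> \<le> b
      \<and> b < nat \<lceil>2 * p * real ((2::nat) ^ (20 * h))\<rceil> \<and> c b \<noteq> 0}"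
    using eventually_compose_filterlim[OF eventually_card_nonzero_ge[OF dens \<open>0 < \<rho>\<close> \<open>1 \<le> p\<close>] pow] .
  have "\<forall>\<^sub>F h in sequentially. False"
    using eventually_block_small[OF q0 l0] eventually_Dirichlet_bound_small[OF l0] eventually_exceptions_few[OF q0 a0 \<open>0 < \<rho>\<close>]
      eventually_energy_large[OF q0 k1 measure_nonneg \<open>0 < \<rho>\<close>, of lebesgue A] eventually_ln_range_le[OF q0] eventually_window_small[OF q0] ev
      eventually_ge_at_top[of "n0 + 1"]
  proof eventually_elim
    case (elim h)
    define s :: nat where "s = 2 ^ (20 * h)"
    have s: "real s = 2 ^ (20 * h)" by (simp add: s_def)
    have sh: "h < s"
    proof -
      have "h \<le> 20 * h" by simp
      also have "20 * h < 2 ^ (20 * h)" by (rule less_exp)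
      finally show ?thesis by (simp add: s_def)
    qed
    define X where "X = nat \<lceil>3 / 2 * p * real s\<rceil>"
    define Y where "Y = nat \<lceil>2 * p * real s\<rceil>"
    define S where "S = {b. X \<le> b \<and> b < Y \<and> c b \<noteq> c (b - 1)}"
    define W where "W = nat \<lceil>q0 * (E h + 2)\<rceil>"
    have E0: "0 \<le> E h" by (simp add: E_def)
    have E2: "0 \<le> q0 * (E h + 2)" using q0 E0 by simp
    have W: "q0 * (E h + 2) \<le> W" "W \<le> q0 * (E h + 2) + 1" using E2 unfolding W_def by linarith+
    have n: "4 * q0 * s \<le> n h" "n h \<le> 4 * q0 * s + 1"
      using q0 unfolding n_def s[symmetric] by (simp_all add: of_nat_ceiling)
    have "1 * real s \<le> q0 * real s" using q0 by (intro mult_right_mono) auto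
    then have nn0: "n0 \<le> n h" using n sh elim(8) by linarith
    have ln: "ln (n h) powr (1 / 4) \<le> E h"
    proof -
      have "1 \<le> real (n h)" using \<open>1 * real s \<le> q0 * real s\<close> n sh by linarith
      then have "ln (n h) \<le> ln (4 * q0 * 2 ^ (20 * h) + 1)" "0 \<le> ln (real (n h))" using n s by auto
      then show ?thesis unfolding E_def using elim(5) by (intro powr_mono2) auto
    qed
    have qs: "\<bar>quasi_sum c y i t\<bar> \<le> E h" if "y \<in> A" "i \<le> t" "\<lfloor>real t * y\<rfloor> \<le> int (n h)" for y i t
      using bounded[OF that(1) nn0 that(2,3)] ln by linarith
    have walk: "\<bar>walk c s y k\<bar> \<le> E h" if y: "y \<in> A" and k: "k < 2 * s" for y k
    proof (cases "s < k")
      case True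
      then have "{s..<k} = {s..k - 1}" by auto
      then have "walk c s y k = of_int (quasi_sum c y s (k - 1))" by (simp add: walk_def quasi_sum_def)
      moreover have "real (k - 1) * y \<le> real (2 * s) * (2 * q0)"
        using y A(2) k \<open>1 \<le> g\<close> by (intro mult_mono) (auto simp: q0_def)
      then have "\<lfloor>real (k - 1) * y\<rfloor> \<le> int (n h)" using n by (simp add: mult_ac) linarith
      then have "\<bar>quasi_sum c y s (k - 1)\<bar> \<le> E h" using True y by (intro qs) auto
      ultimately show ?thesis by simp
    qed (simp add: walk_def E0)
    have YW: "Y + W \<le> n h"
    proof -
      have "2 * p * s \<le> 2 * q0 * s" using pq by (intro mult_right_mono) (auto simp: q0_def)
      moreover have "0 \<le> 2 * p * s" using \<open>1 \<le> p\<close> by simp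
      then have "Y \<le> 2 * p * s + 1" unfolding Y_def by linarith
      moreover have "q0 * (E h + 2) + 3 \<le> q0 * s" using elim(6) by (simp add: s E_def)
      moreover have "0 \<le> q0 * real s" using q0 by simp
      ultimately have "real Y + W \<le> n h" using W n by linarith
      then show ?thesis by linarith
    qed
    \<comment> \<open>One point of \<open>A\<close> suffices to bound the constant runs, since the
      conclusion concerns \<open>c\<close> alone.\<close>
    obtain y0 where y0: "y0 \<in> A" using A0 by force
    have "card {b. X \<le> b \<and> b < Y \<and> c b \<noteq> 0} \<le> W * card S + W"
      unfolding S_def
    proof (rule card_nonzero_le[OF _ YW])
      fix x assume "x + W \<le> n h" "c x \<noteq> 0"
      then show "\<exists>b>x. b < x + W \<and> c b \<noteq> c (b - 1)"
        using y0 A(2) \<open>1 \<le> g\<close> qs[OF y0] W(1) E0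
        by (intro no_long_constant_runs[of y0 q0 "E h" W x "n h"]) (auto simp: q0_def)
    qed
    then have "real (card {b. X \<le> b \<and> b < Y \<and> c b \<noteq> 0}) \<le> W * (real (card S) + 1)"
      by (simp add: algebra_simps flip: of_nat_mult of_nat_add)
    also have "\<dots> \<le> (q0 * (E h + 2) + 1) * (real (card S) + 1)" using W by (intro mult_right_mono) auto
    finally have "\<rho> * s / 4 \<le> (q0 * (E h + 2) + 1) * (real (card S) + 1)"
      using elim(7) unfolding X_def Y_def s_def by linarith
    then have cardS: "M h \<le> card S" using E2 unfolding M_def s[symmetric] by (simp add: field_simps)
    \<comment> \<open>\<open>8 * s * u = 8 * a / 2 ^ Suc r\<close> and
      \<open>Suc r \<le> 2 * h\<close>, so one \<open>Q\<close> satisfies \<open>Q_large\<close> for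
      all \<open>r\<close>.\<close>
    define Q where "Q = nat \<lceil>(2 :: real) ^ (2 * h) / (8 * a)\<rceil>"
    have Q: "2 ^ (2 * h) / (8 * a) \<le> Q" "Q \<le> Z h" unfolding Q_def Z_def using a0 by (simp_all add: of_nat_ceiling)
    have scale: "crossing_scale A S p q q0 (a / (2 ^ (20 * h) * 2 ^ Suc r)) (2 ^ (20 * h)) (2 ^ r) (2 ^ (10 * h)) Q"
      if r: "h \<le> r" "r < 2 * h" for r
    proof -
      define u where "u = a / (2 ^ (20 * h) * 2 ^ Suc r)"
      have su: "real s * u = a / 2 ^ Suc r" by (simp add: u_def s)
      have mu: "real (m * s) * u = m * (a / 2 ^ Suc r)" for m
        unfolding of_nat_mult mult.assoc su by (rule refl)
      have pw: "(2::real) ^ r \<le> 2 ^ (2 * h)" "(2::real) ^ Suc r \<le> 2 ^ (2 * h)"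
        using r by (auto intro!: power_increasing simp del: power_Suc)
      have "crossing_scale A S p q q0 u s (2 ^ r) (2 ^ (10 * h)) Q"
      proof
        show "2 * q \<le> 3 * p" "1 \<le> p" "p < q" "q \<le> q0" using pq \<open>1 \<le> g\<close> by (auto simp: q0_def)
        show "A \<in> lmeasurable" by fact
        show "even (2 ^ r :: nat)" using r elim(8) by simp
        show "2 * 2 ^ r dvd s" unfolding s_def power_Suc[symmetric] using r by (intro le_imp_power_dvd) simp
        show "0 < u" using a0 by (simp add: u_def)
        show "3 / 2 * p * s \<le> b \<and> b < 2 * p * s" if "b \<in> S" for b
        proof -
          have "nat \<lceil>3 / 2 * p * real s\<rceil> \<le> b" "b < nat \<lceil>2 * p * real s\<rceil>"
            using that by (auto simp: S_def X_def Y_def)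
          then show ?thesis by linarith
        qed
        have "2 * q0 * (1 + 2 ^ r) \<le> 2 * q0 * (1 + 2 ^ (2 * h))" using pw q0 by (intro mult_left_mono) auto
        then show "2 * q0 * real (1 + 2 ^ r) \<le> s * (q - p)" using elim(1) pq by (simp add: s)
        show "16 * s * u < 1"
        proof -
          have "16 * (a / 2 ^ Suc r) \<le> 16 * (a / 2)" using a0 by (intro mult_left_mono divide_left_mono) auto
          moreover have "real (16 * s) * u = 16 * (a / 2 ^ Suc r)" unfolding mu by simp
          ultimately show ?thesis using a1 a0 by linarith
        qed
        show "real (2 ^ (10 * h)) \<le> s * (q - p)" using elim(2) pq by (simp add: s)
        show "1 \<le> 8 * s * u * Q"
        proof -
          have "8 * (a / 2 ^ Suc r) * (2 ^ Suc r / (8 * a)) \<le> 8 * (a / 2 ^ Suc r) * Q"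
          proof (intro mult_left_mono)
            have "2 ^ Suc r / (8 * a) \<le> 2 ^ (2 * h) / (8 * a)" using pw a0 by (intro divide_right_mono) auto
            then show "2 ^ Suc r / (8 * a) \<le> Q" using Q by linarith
          qed (use a0 in auto)
          moreover have "8 * (a / 2 ^ Suc r) * (2 ^ Suc r / (8 * a)) = 1" using a0 by simp
          moreover have "real (8 * s) * u = 8 * (a / 2 ^ Suc r)" unfolding mu by simp
          ultimately show ?thesis by simp
        qed
        show "3 * (real Q * (2 * real Q + 1) * (4 * q0 * s / real (2 ^ (10 * h)) + 1)) \<le> 160 * s * u * card S"
        proof -
          have "3 * (real Q * (2 * real Q + 1) * (4 * q0 * s / real (2 ^ (10 * h)) + 1))
             \<le> 3 * (Z h * (2 * Z h + 1) * (4 * q0 * s / 2 ^ (10 * h) + 1))"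
            using Q q0 by (intro mult_left_mono mult_mono add_mono) auto
          also have "\<dots> \<le> 160 * (a / 2 ^ (2 * h)) * M h"
            using elim(3) by (simp only: Z_def M_def E_def s)
          also have "\<dots> \<le> 160 * (a / 2 ^ (2 * h)) * card S" using cardS a0 by (intro mult_left_mono) auto
          also have "\<dots> \<le> 160 * (a / 2 ^ Suc r) * card S"
            using pw a0 by (intro mult_right_mono mult_left_mono divide_left_mono) auto
          also have "160 * (a / 2 ^ Suc r) = real (160 * s) * u" unfolding mu by simp
          finally show ?thesis .
        qed
        have "measure lebesgue ({p - u<..<q + u} - (A - near_rational (2 * 2 ^ r) (4 * s * u)))
          \<le> \<eta> * (q - p) + 40 * a"
        proof (rule measure_bad_le[OF A(1) pq(2) _ dense a1])
          show "q - p \<le> 1" using pq by simp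
          show "0 < u" using a0 by (simp add: u_def)
          have "(1::real) * 1 \<le> 2 ^ (20 * h) * 2 ^ Suc r" by (intro mult_mono one_le_power) auto
          then have "a / (2 ^ (20 * h) * 2 ^ Suc r) \<le> a / 1" using a0 by (intro divide_left_mono) auto
          then show "u \<le> a" by (simp add: u_def)
          have u4: "real (4 * s) * u = 4 * (a / 2 ^ Suc r)" unfolding mu by simp
          \<comment> \<open>The block length cancels the factor \<open>1 / 2 ^ Suc r\<close> in
            \<open>u\<close>, so the near-rational points cost \<open>O(a)\<close> uniformly in
            \<open>r\<close>.\<close>
          show "real (2 * 2 ^ r) * (4 * s * u) = 4 * a" "0 < 4 * s * u" unfolding u4 using a0 by auto
          have "4 * (a / 2 ^ Suc r) \<le> 4 * (a / 2)" using a0 by (intro mult_left_mono divide_left_mono) auto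
          then show "4 * s * u \<le> 1 / 2" unfolding u4 using a1 by linarith
        qed
        then show "measure lebesgue ({p - u<..<q + u} - (A - near_rational (2 * 2 ^ r) (4 * s * u)))
          \<le> (q - p) / (10240 * q0\<^sup>2)" using C1 by linarith
      qed (auto simp: s_def)
      then show ?thesis unfolding u_def s_def .
    qed
    have "real h * (a * card S * (q - p) / (512 * q0)) \<le> 2 ^ (20 * h) * (E h)\<^sup>2 * measure lebesgue A"
    proof (rule energy_bound[OF scale])
      show "\<And>b. b \<in> S \<Longrightarrow> c b \<noteq> c (b - 1)" by (simp add: S_def)
      show "\<bar>walk c (2 ^ (20 * h)) y k\<bar> \<le> E h" if "y \<in> A" "k < 2 * 2 ^ (20 * h)" for y k
        using walk[of y k] that by (simp add: s_def)
    qed (use A q0 in auto)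
    moreover have "real h * (a * (q - p) / (512 * q0) * M h) \<le> real h * (a * (q - p) / (512 * q0) * card S)"
      using cardS k1 by (intro mult_left_mono) auto
    moreover have "2 ^ (20 * h) * (E h)\<^sup>2 * measure lebesgue A < real h * (a * (q - p) / (512 * q0) * M h)"
      using elim(4) by (simp only: M_def E_def)
    ultimately show False by (simp add: mult_ac)
  qed
  then show False by simp
qed

section \<open>Null sets and the almost-everywhere statement\<close>

lemma quasi_sum_le_quasi_discrepancy:
  assumes "1 \<le> y" "i \<le> t" "\<lfloor>real t * y\<rfloor> \<le> int n"
  shows "\<bar>quasi_sum c y i t\<bar> \<le> quasi_discrepancy c y n"
proof -
  let ?X = "{\<bar>quasi_sum (restrict c {..n}) y s t\<bar> | s t. s \<le> t \<and> \<lfloor>real t * y\<rfloor> \<le> int n}"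
  have "?X \<subseteq> (\<lambda>(s, t). \<bar>quasi_sum (restrict c {..n}) y s t\<bar>) ` ({..n} \<times> {..n})"
  proof
    fix x assume "x \<in> ?X"
    then obtain s t where st: "x = \<bar>quasi_sum (restrict c {..n}) y s t\<bar>" "s \<le> t" "\<lfloor>real t * y\<rfloor> \<le> int n"
      by blast
    have "real t * 1 \<le> real t * y" using assms(1) by (intro mult_left_mono) auto
    then have "t \<le> n" using st(3) by linarith
    then show "x \<in> (\<lambda>(s, t). \<bar>quasi_sum (restrict c {..n}) y s t\<bar>) ` ({..n} \<times> {..n})"
      using st by force
  qed
  then have "finite ?X" by (rule finite_subset) simp
  moreover have "quasi_sum c y i t = quasi_sum (restrict c {..n}) y i t"
    unfolding quasi_sum_def
  proof (intro sum.cong refl)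
    fix k assume k: "k \<in> {i..t}"
    then have "real k * y \<le> real t * y" using assms(1) by (intro mult_right_mono) auto
    then have "nat \<lfloor>real k * y\<rfloor> \<le> n" using assms(3) floor_mono[of "real k * y" "real t * y"] by linarith
    then show "c (nat \<lfloor>real k * y\<rfloor>) = restrict c {..n} (nat \<lfloor>real k * y\<rfloor>)" by simp
  qed
  ultimately show ?thesis unfolding quasi_discrepancy_def using assms by (intro Max_ge) auto
qed

text \<open>Formulated with individual sums instead of \<open>quasi_discrepancy\<close>, so that it
  is a countable intersection of Borel sets.\<close>

definition bounded_discrepancy :: "(nat \<Rightarrow> int) \<Rightarrow> nat \<Rightarrow> real set" where
  "bounded_discrepancy c n0 = {y. \<forall>n\<ge>n0. \<forall>i t. i \<le> t \<longrightarrow> \<lfloor>real t * y\<rfloor> \<le> int n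
     \<longrightarrow> real_of_int \<bar>quasi_sum c y i t\<bar> \<le> ln (real n) powr (1 / 4)}"

lemma borel_bounded_discrepancy: "bounded_discrepancy c n0 \<in> sets borel"
proof -
  define X where "X n i t = {y \<in> space borel. real n + 1 \<le> real t * y} \<union>
      {y \<in> space borel. real_of_int \<bar>quasi_sum c y i t\<bar> \<le> ln (real n) powr (1 / 4)}" for n i t
  have eq: "bounded_discrepancy c n0 = (\<Inter>n\<in>{n0..}. \<Inter>i. \<Inter>t\<in>{i..}. X n i t)"
  proof -
    have "y \<in> X n i t \<longleftrightarrow> (\<lfloor>real t * y\<rfloor> \<le> int n \<longrightarrow> real_of_int \<bar>quasi_sum c y i t\<bar> \<le> ln (real n) powr (1 / 4))"
      for y n i t
    proof -
      have "\<lfloor>real t * y\<rfloor> \<le> int n \<longleftrightarrow> \<not> real n + 1 \<le> real t * y" by linarith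
      then show ?thesis by (auto simp: X_def)
    qed
    then show ?thesis
      by (simp only: set_eq_iff bounded_discrepancy_def mem_Collect_eq INT_iff atLeast_iff) blast
  qed
  have qs: "(\<lambda>y. real_of_int \<bar>quasi_sum c y i t\<bar>) \<in> borel_measurable borel" for i t
    unfolding quasi_sum_def of_int_abs of_int_sum
    by (intro borel_measurable_abs borel_measurable_sum borel_measurable_term)
  have "X n i t \<in> sets borel" for n i t
    unfolding X_def by (intro sets.Un borel_measurable_le qs borel_measurable_const borel_measurable_times measurable_ident_sets[OF refl])
  then show ?thesis unfolding eq by (intro sets.countable_INT'') auto
qed

lemma null_sets_bounded_discrepancy:
  assumes "colouring_density c \<rho>" "0 < \<rho>" "1 \<le> g"
  shows "bounded_discrepancy c n0 \<inter> {g..g + 1 / 2} \<in> null_sets lebesgue"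
proof -
  let ?A = "bounded_discrepancy c n0 \<inter> {g..g + 1 / 2}"
  have A: "?A \<in> lmeasurable"
    using borel_bounded_discrepancy[of c n0] by (subst Int_commute) (auto intro!: fmeasurable_Int_fmeasurable)
  have "measure lebesgue ?A = 0"
  proof (rule negligible_bounded_discrepancy[OF assms A])
    fix y n i t
    assume "y \<in> ?A" "n0 \<le> n" "i \<le> t" "\<lfloor>real t * y\<rfloor> \<le> int n"
    then show "real_of_int \<bar>quasi_sum c y i t\<bar> \<le> ln (real n) powr (1 / 4)"
      unfolding bounded_discrepancy_def by blast
  qed blast
  then have "emeasure lebesgue ?A = 0" using emeasure_eq_measure2[OF A] by simp
  then show ?thesis using fmeasurableD[OF A] by (rule null_setsI)
qed

theorem theorem2:
  fixes c :: "nat \<Rightarrow> int" and \<rho> :: real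
  assumes "partial_colouring c"
    and "colouring_density c \<rho>"
    and "\<rho> > 0"
  shows "AE \<alpha> in lebesgue_on {1..}. \<forall>\<epsilon>>0.
           infinite {n::nat. real_of_int (quasi_discrepancy c \<alpha> n) \<ge> ln (real n) powr (1/4 - \<epsilon>)}"
proof -
  \<comment> \<open>The intervals of length \<open>1 / 2\<close> cover
    \<open>[1, \<infinity>)\<close>.\<close>
  define N where "N = (\<Union>n0. \<Union>m::nat. bounded_discrepancy c n0 \<inter> {1 + real m / 2..1 + real m / 2 + 1 / 2})"
  have "N \<in> null_sets lebesgue"
    unfolding N_def using assms by (intro null_sets_UN null_sets_bounded_discrepancy) auto
  then have "AE \<alpha> in lebesgue. \<alpha> \<notin> N" by (rule AE_not_in)
  then have "AE \<alpha> in lebesgue. \<alpha> \<in> {1..} \<longrightarrow> (\<forall>\<epsilon>>0.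
       infinite {n::nat. real_of_int (quasi_discrepancy c \<alpha> n) \<ge> ln (real n) powr (1/4 - \<epsilon>)})"
  proof (rule AE_mp, intro AE_I2 impI allI notI)
    fix \<alpha> \<epsilon> :: real
    assume \<alpha>: "\<alpha> \<notin> N" "\<alpha> \<in> {1..}" and "0 < \<epsilon>"
      and fin: "finite {n::nat. real_of_int (quasi_discrepancy c \<alpha> n) \<ge> ln (real n) powr (1/4 - \<epsilon>)}"
    obtain n1 where n1: "\<And>n. real_of_int (quasi_discrepancy c \<alpha> n) \<ge> ln (real n) powr (1/4 - \<epsilon>) \<Longrightarrow> n < n1"
      using fin by (auto simp: finite_nat_set_iff_bounded)
    \<comment> \<open>Beyond \<open>n1\<close> the discrepancy is below
      \<open>ln n powr (1/4 - \<epsilon>)\<close>. From \<open>3\<close> on,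
      \<open>ln n \<ge> 1\<close>, so the exponent may be raised to \<open>1 / 4\<close>, which
      removes the dependence on \<epsilon>.\<close>
    have "\<alpha> \<in> bounded_discrepancy c (max n1 3)"
      unfolding bounded_discrepancy_def
    proof (intro CollectI allI impI)
      fix n i t assume n: "max n1 3 \<le> n" and it: "i \<le> t" "\<lfloor>real t * \<alpha>\<rfloor> \<le> int n"
      have "exp 1 \<le> real n" using n exp_le by linarith
      then have "1 \<le> ln (real n)" using ln_ge_iff[of "real n" 1] n by simp
      then have "ln (real n) powr (1/4 - \<epsilon>) \<le> ln (real n) powr (1 / 4)"
        using \<open>0 < \<epsilon>\<close> by (intro powr_mono) auto
      moreover have "real_of_int (quasi_discrepancy c \<alpha> n) < ln (real n) powr (1/4 - \<epsilon>)"
        using n1[of n] n by force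
      moreover have "\<bar>quasi_sum c \<alpha> i t\<bar> \<le> quasi_discrepancy c \<alpha> n"
        using \<alpha> it by (intro quasi_sum_le_quasi_discrepancy) auto
      ultimately show "real_of_int \<bar>quasi_sum c \<alpha> i t\<bar> \<le> ln (real n) powr (1 / 4)" by linarith
    qed
    moreover
    define m where "m = nat \<lfloor>2 * (\<alpha> - 1)\<rfloor>"
    have "0 \<le> 2 * (\<alpha> - 1)" using \<alpha>(2) by simp
    then have "real m \<le> 2 * (\<alpha> - 1)" "2 * (\<alpha> - 1) < real m + 1" unfolding m_def by linarith+
    then have "1 + real m / 2 \<le> \<alpha>" "\<alpha> \<le> 1 + real m / 2 + 1 / 2" by (simp_all add: field_simps)
    ultimately have "\<alpha> \<in> N" unfolding N_def by auto
    with \<alpha>(1) show False by contradiction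
  qed
  then show ?thesis by (subst AE_restrict_space_iff) auto
qed

end
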